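(* Let $A\in\mathbb{R}^{n\times n}$, $b\in\mathbb{R}^{n\times m}$, $C\in\mathbb{R}^{n\times n}$, $G=G^\top\in\mathbb{R}^{n\times n}$, $\gamma\in\mathbb{R}^{n\times m}$, $\Gamma=\Gamma^\top\in\mathbb{R}^{m\times m}$, with $\rho(A)<1$, and let $\mathbf{U}=\{(u_t)_{t\ge 0}:u_t\in\mathbb{R}^m,\ \sum_{t=0}^{\infty}|u_t|^2<\infty\}$. Assume that the system $$x_{t+1}=Ax_t+bu_t+Cx_t\xi_{t+1}\quad(t=0,1,2,\dots),\qquad x_0=a,$$ is stable in the mean-square sense for $u_t\equiv 0$. Let $H,\Theta\in\mathbb{C}^{n\times n}$ be symmetric matrices satisfying $$A^\top HA-H+\Theta=0,\qquad \Theta-C^\top HC-G=0.$$ Consider the following two problems. Stochastic problem: minimize over $u\in\mathbf{U}$ $$\Phi(u)=\sum_{t=0}^{\infty}\mathbf{E}\left[x_t^*Gx_t+2\,\mathrm{Re}\,x_t^*\gamma u_t+u_t^*\Gamma u_t\right],$$ where $(x_t)$ is the solution of the system above corresponding to $u$. Deterministic problem: minimize over $u\in\mathbf{U}$ $$\Phi_1(u)=\sum_{t=0}^{\infty}\left[y_t^*\Theta y_t+2\,\mathrm{Re}\,y_t^*\gamma u_t+u_t^*\Gamma u_t\right],$$ where $y_{t+1}=Ay_t+bu_t$ for $t=0,1,2,\dots$ and $y_0=\mathbf{E}\,a$. Then an optimal control for the stochastic problem exists if and only if an optimal control for the deterministic problem exists. Furthermore, if there exists $\delta>0$ such that $$\mathcal{F}(g(z)bu,u)\ge\delta|u|^2\qquad\text{for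 all } z\in\mathbb{C}\text{ with }|z|=1\text{ and all }u\in\mathbb{C}^m,$$ where $\mathcal{F}(x,u)=x^*\Theta x+2\,\mathrm{Re}\,x^*\gamma u+u^*\Gamma u$ and $g(z)=(zI-A)^{-1}$, then the optimal controls in the stochastic problem and in the deterministic problem are identical and unique up to equivalence.
   Context: $(\Omega,\mathscr{F},\mathbf{P})$ is a standard probability space with a non-decreasing flow of $\sigma$-algebras $\mathscr{F}_t\subset\mathscr{F}$. The scalar real process $\xi_t$ is discrete-time white noise adapted to $\mathscr{F}_t$ with $\mathbf{E}\,\xi_t=0$, $\mathbf{Var}(\xi_t)=1$, where $\xi_{t+1}$ is independent of $\mathscr{F}_t$. The random vector $a$ with values in $\mathbb{R}^n$ is $\mathscr{F}_0$-measurable, independent of $\{\xi_t\}_{t\ge 0}$, with $\mathbf{E}|a|^2<\infty$ and $\mathbf{E}|aa^\top|^2<\infty$. Here $|\cdot|$ is the Euclidean norm for vectors and the Frobenius norm for matrices, $\rho(\cdot)$ is the spectral radius, $^\top$ is transpose, and $^*$ is conjugate transpose. An optimal control for a problem is an element of $\mathbf{U}$ at which the functional attains its minimum over $\mathbf{U}$. The controls in $\mathbf{U}$ are deterministic sequences, and two controls $u,v\in\mathbf{U}$ are equivalent if $\sum_t|u_t-v_t|^2=0$. Mean-square stability for $u_t\equiv 0$ means that the solution of $x_{t+1}=Ax_t+Cx_t\xi_{t+1}$ satisfies $\mathbf{E}|x_t|^2\to 0$ for every $\mathscr{F}_0$-measurable random initial vector $x_0$ with values in $\mathbb{R}^n$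 that is independent of $\{\xi_t\}_{t\ge 0}$ and satisfies $\mathbf{E}|x_0|^2<\infty$ and $\mathbf{E}|x_0x_0^\top|^2<\infty$; equivalently, $\rho(A\otimes A+C\otimes C)<1$, where $\otimes$ is the Kronecker product. *)

theory Defs
  imports "HOL-Probability.Probability"
begin

text \<open>An \<open>n \<times> m\<close> matrix has type \<open>real ^ 'm ^ 'n\<close>; the dimensions are the
  cardinalities of the arbitrary finite types \<open>'n\<close> and \<open>'m\<close>. The norm of the library on
  \<open>real ^ 'm ^ 'n\<close> is the Frobenius norm.

  Inequalities between complex numbers are those of \<open>HOL-Library.Complex_Order\<close>: for
  \<open>z \<le> w\<close> the imaginary parts must agree.\<close>

definition cvec :: "real ^ 'n \<Rightarrow> complex ^ 'n" where
  "cvec x = (\<chi> i. complex_of_real (x $ i))"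

abbreviation cmat :: "real ^ 'm ^ 'n \<Rightarrow> complex ^ 'm ^ 'n" where
  "cmat \<equiv> map_matrix complex_of_real"

text \<open>\<open>star_prod x y\<close> is \<open>x\<^sup>* y\<close>, conjugate-linear in the first argument.\<close>

definition star_prod :: "complex ^ 'n \<Rightarrow> complex ^ 'n \<Rightarrow> complex" where
  "star_prod x y = (\<Sum>i\<in>UNIV. cnj (x $ i) * y $ i)"

text \<open>The maximum is over the nonempty finite set of complex eigenvalues.\<close>

definition matrix_spectral_radius :: "complex ^ 'n ^ 'n \<Rightarrow> real" where
  "matrix_spectral_radius A = Max {cmod l | l. \<exists>v. v \<noteq> 0 \<and> A *v v = l *s v}"


definition indep_sigma :: "'w measure \<Rightarrow> 'w measure \<Rightarrow> 'w measure \<Rightarrow> bool" where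
  "indep_sigma M A B \<longleftrightarrow> prob_space.indep_set M (sets A) (sets B)"

definition white_noise :: "'w measure \<Rightarrow> (nat \<Rightarrow> 'w measure) \<Rightarrow> (nat \<Rightarrow> 'w \<Rightarrow> real) \<Rightarrow> bool" where
  "white_noise M F \<xi> \<longleftrightarrow>
     (\<forall>t. \<xi> t \<in> borel_measurable (F t)
        \<and> integrable M (\<xi> t) \<and> integrable M (\<lambda>\<omega>. (\<xi> t \<omega>)\<^sup>2)
        \<and> prob_space.expectation M (\<xi> t) = 0
        \<and> prob_space.variance M (\<xi> t) = 1
        \<and> indep_sigma M (vimage_algebra (space M) (\<xi> (Suc t)) borel) (F t))"

text \<open>Independence of the whole family \<open>\<xi>\<close> means independence of the sigma-algebra it
  generates, which is that of \<open>\<xi>\<close> as a single map into the product space.\<close>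

definition admissible_init ::
  "'w measure \<Rightarrow> (nat \<Rightarrow> 'w measure) \<Rightarrow> (nat \<Rightarrow> 'w \<Rightarrow> real) \<Rightarrow> ('w \<Rightarrow> real ^ 'n) \<Rightarrow> bool" where
  "admissible_init M F \<xi> a \<longleftrightarrow>
     a \<in> borel_measurable (F 0)
     \<and> indep_sigma M (vimage_algebra (space M) a borel)
         (vimage_algebra (space M) (\<lambda>\<omega> t. \<xi> t \<omega>) (Pi\<^sub>M UNIV (\<lambda>_. borel)))
     \<and> integrable M (\<lambda>\<omega>. (norm (a \<omega>))\<^sup>2)
     \<and> integrable M (\<lambda>\<omega>. (norm ((columnvector (a \<omega>) :: real ^ 1 ^ 'n) ** rowvector (a \<omega>)))\<^sup>2)"

primrec state ::
  "real ^ 'n ^ 'n \<Rightarrow> real ^ 'm ^ 'n \<Rightarrow> real ^ 'n ^ 'n \<Rightarrow> (nat \<Rightarrow> 'w \<Rightarrow> real) \<Rightarrow> ('w \<Rightarrow> real ^ 'n)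
    \<Rightarrow> (nat \<Rightarrow> real ^ 'm) \<Rightarrow> nat \<Rightarrow> 'w \<Rightarrow> real ^ 'n" where
  "state A b C \<xi> a u 0 = a"
| "state A b C \<xi> a u (Suc t) = (\<lambda>\<omega>. A *v state A b C \<xi> a u t \<omega> + b *v u t
      + \<xi> (Suc t) \<omega> *\<^sub>R (C *v state A b C \<xi> a u t \<omega>))"

primrec det_state ::
  "real ^ 'n ^ 'n \<Rightarrow> real ^ 'm ^ 'n \<Rightarrow> real ^ 'n \<Rightarrow> (nat \<Rightarrow> real ^ 'm) \<Rightarrow> nat \<Rightarrow> real ^ 'n" where
  "det_state A b y0 u 0 = y0"
| "det_state A b y0 u (Suc t) = A *v det_state A b y0 u t + b *v u t"

definition mean_square_stable ::
  "'w measure \<Rightarrow> (nat \<Rightarrow> 'w measure) \<Rightarrow> (nat \<Rightarrow> 'w \<Rightarrow> real)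
    \<Rightarrow> real ^ 'n ^ 'n \<Rightarrow> real ^ 'm ^ 'n \<Rightarrow> real ^ 'n ^ 'n \<Rightarrow> bool" where
  "mean_square_stable M F \<xi> A b C \<longleftrightarrow>
     (\<forall>x0. admissible_init M F \<xi> x0 \<longrightarrow>
        (\<lambda>t. prob_space.expectation M (\<lambda>\<omega>. (norm (state A b C \<xi> x0 (\<lambda>_. 0) t \<omega>))\<^sup>2))
          \<longlonglongrightarrow> 0)"


definition controls :: "(nat \<Rightarrow> real ^ 'm) set" where
  "controls = {u. summable (\<lambda>t. (norm (u t))\<^sup>2)}"

definition control_equiv :: "(nat \<Rightarrow> real ^ 'm) \<Rightarrow> (nat \<Rightarrow> real ^ 'm) \<Rightarrow> bool" where
  "control_equiv u v \<longleftrightarrow> (\<lambda>t. (norm (u t - v t))\<^sup>2) sums 0"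

definition optimal_control :: "((nat \<Rightarrow> real ^ 'm) \<Rightarrow> 'c::order) \<Rightarrow> (nat \<Rightarrow> real ^ 'm) \<Rightarrow> bool" where
  "optimal_control J u \<longleftrightarrow> u \<in> controls \<and> (\<forall>v\<in>controls. J u \<le> J v)"

definition cost_form ::
  "complex ^ 'n ^ 'n \<Rightarrow> complex ^ 'm ^ 'n \<Rightarrow> complex ^ 'm ^ 'm
    \<Rightarrow> complex ^ 'n \<Rightarrow> complex ^ 'm \<Rightarrow> complex" where
  "cost_form Q \<gamma> \<Gamma> x u =
     star_prod x (Q *v x) + complex_of_real (2 * Re (star_prod x (\<gamma> *v u))) + star_prod u (\<Gamma> *v u)"

text \<open>All data of the stochastic cost are real, so \<open>\<^sup>*\<close> is the transpose and the real part
  is redundant.\<close>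

definition stoch_cost ::
  "'w measure \<Rightarrow> (nat \<Rightarrow> 'w \<Rightarrow> real) \<Rightarrow> ('w \<Rightarrow> real ^ 'n)
    \<Rightarrow> real ^ 'n ^ 'n \<Rightarrow> real ^ 'm ^ 'n \<Rightarrow> real ^ 'n ^ 'n
    \<Rightarrow> real ^ 'n ^ 'n \<Rightarrow> real ^ 'm ^ 'n \<Rightarrow> real ^ 'm ^ 'm \<Rightarrow> (nat \<Rightarrow> real ^ 'm) \<Rightarrow> real" where
  "stoch_cost M \<xi> a A b C G \<gamma> \<Gamma> u =
     (\<Sum>t. prob_space.expectation M (\<lambda>\<omega>. let x = state A b C \<xi> a u t \<omega> in
        x \<bullet> (G *v x) + 2 * (x \<bullet> (\<gamma> *v u t)) + u t \<bullet> (\<Gamma> *v u t)))"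

text \<open>Complex-valued, as \<open>\<Theta>\<close> is a complex matrix.\<close>

definition det_cost ::
  "real ^ 'n ^ 'n \<Rightarrow> real ^ 'm ^ 'n \<Rightarrow> real ^ 'n
    \<Rightarrow> complex ^ 'n ^ 'n \<Rightarrow> real ^ 'm ^ 'n \<Rightarrow> real ^ 'm ^ 'm \<Rightarrow> (nat \<Rightarrow> real ^ 'm) \<Rightarrow> complex" where
  "det_cost A b y0 \<Theta> \<gamma> \<Gamma> u =
     (\<Sum>t. cost_form \<Theta> (cmat \<gamma>) (cmat \<Gamma>) (cvec (det_state A b y0 u t)) (cvec (u t)))"

end

theory Submission
  imports Defs
begin

text \<open>Mean-square stability applied to deterministic initial vectors shows that the powers of
  \<open>X \<mapsto> A X A\<^sup>T + C X C\<^sup>T\<close> and of \<open>A\<close> tend to zero. The first fact makes the equation for \<open>H\<close> uniquely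
  solvable, so \<open>H\<close> and \<open>\<Theta>\<close> are real. Since \<open>E x\<^sub>t = y\<^sub>t\<close>, the equations for \<open>H\<close> and \<open>\<Theta>\<close> make the
  difference of the two running costs telescope to differences of \<open>tr (H Cov x\<^sub>t)\<close>, and \<open>Cov x\<^sub>t\<close> tends
  to zero. Hence \<open>\<Phi> u = \<Phi>\<^sub>1 u + tr (H Cov a)\<close> on the controls.

  The frequency condition gives \<open>\<Phi>\<^sub>1 u \<ge> \<delta> |u|\<^sup>2\<close> for zero initial state: by the Parseval identity of the
  discrete Fourier transform it holds for \<open>N\<close>-periodic trajectories, and these approximate the
  trajectory of \<open>u\<close> on the first \<open>N\<close> steps. A coercive quadratic functional on square-summable
  sequences has a minimizer, unique up to equivalence, by the parallelogram identity.\<close>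

section \<open>Powers of stable linear maps\<close>

text \<open>Stability is used in the form that all orbits \<open>(f ^^ t) x\<close> tend to zero,
  for \<open>f\<close> the covariance map and for \<open>f\<close> the matrix \<open>A\<close>. In
  finite dimension this gives an adapted norm in which \<open>f\<close> is a strict contraction,
  hence bounds for forced recursions that are uniform in the horizon. The bound on norms serves the
  covariances, whose forcing is quadratic in \<open>y\<^sub>t\<close>; the bound on squared norms
  serves \<open>y\<^sub>t\<close> itself. That \<Theta> is real is more than a convenience: the
  deterministic cost is complex valued, and two complex numbers are comparable only if their
  imaginary parts agree. The constant that separates the two costs does not involve the control, so
  minimizers transfer with no condition on frequencies. That condition is needed for coercivity
  alone, and zero initial state suffices there because the initial state only affects the terms of
  the cost of degree at most one in the control.\<close>

lemma linear_funpow: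
  fixes f :: "'a::real_vector \<Rightarrow> 'a"
  assumes "linear f"
  shows "linear (f ^^ t)"
proof (induction t)
  case (Suc t)
  then show ?case using assms by (simp add: linear_iff)
qed (simp add: linear_iff)

lemma sum_lessThan_add:
  fixes g :: "nat \<Rightarrow> 'a::comm_monoid_add"
  shows "(\<Sum>t<m + k. g t) = (\<Sum>t<m. g t) + (\<Sum>t<k. g (t + m))"
  by (induction k) (simp_all add: add.assoc add.commute[of m])

text \<open>Convergence at the finitely many basis vectors already controls the operator norm, so
  pointwise decay becomes uniform.\<close>

lemma stable_power_bound:
  fixes f :: "'a::euclidean_space \<Rightarrow> 'a"
  assumes f: "linear f" and lim: "\<And>x. (\<lambda>t. (f ^^ t) x) \<longlonglongrightarrow> 0"
  shows "norm ((f ^^ t) x) \<le> (\<Sum>b\<in>Basis. norm ((f ^^ t) b)) * norm x"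
    and "\<forall>\<^sub>F t in sequentially. \<forall>x. norm ((f ^^ t) x) \<le> norm x / 2"
proof -
  note lin = linear_funpow[OF f]
  show bnd: "norm ((f ^^ t) x) \<le> (\<Sum>b\<in>Basis. norm ((f ^^ t) b)) * norm x" for t x
  proof -
    have "(f ^^ t) x = (f ^^ t) (\<Sum>b\<in>Basis. (x \<bullet> b) *\<^sub>R b)"
      by (simp add: euclidean_representation)
    also have "\<dots> = (\<Sum>b\<in>Basis. (x \<bullet> b) *\<^sub>R (f ^^ t) b)"
      by (simp add: linear_sum[OF lin] linear_scale[OF lin])
    also have "norm \<dots> \<le> (\<Sum>b\<in>Basis. norm x * norm ((f ^^ t) b))"
      by (rule sum_norm_le) (auto intro!: mult_right_mono simp: Basis_le_norm)
    finally show ?thesis by (simp add: sum_distrib_left mult.commute)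
  qed
  have "(\<lambda>t. \<Sum>b\<in>Basis. norm ((f ^^ t) b)) \<longlonglongrightarrow> (\<Sum>b\<in>(Basis::'a set). 0)"
    by (intro tendsto_sum tendsto_norm_zero lim)
  then have "\<forall>\<^sub>F t in sequentially. (\<Sum>b\<in>Basis. norm ((f ^^ t) b)) < 1/2"
    by (intro order_tendstoD(2)[where y = 0]) auto
  then show "\<forall>\<^sub>F t in sequentially. \<forall>x. norm ((f ^^ t) x) \<le> norm x / 2"
  proof eventually_elim
    case (elim t)
    show ?case
      using order_trans[OF bnd mult_right_mono[OF less_imp_le[OF elim] norm_ge_zero]] by simp
  qed
qed

text \<open>Once \<open>f ^^ N\<close> halves every norm, the sum beyond step \<open>N\<close> is a
  shorter sum started at a vector of half the size. If \<open>K\<close> bounds the first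
  \<open>N\<close> steps, strong induction closes with \<open>2 * K\<close>, since
  \<open>K + 2 * K / 2 = 2 * K\<close>.\<close>

lemma stable_partial_sums:
  fixes f :: "'a::euclidean_space \<Rightarrow> 'a"
  assumes f: "linear f" and lim: "\<And>x. (\<lambda>t. (f ^^ t) x) \<longlonglongrightarrow> 0"
  obtains K where "1 \<le> K" "\<And>x n. (\<Sum>t<n. norm ((f ^^ t) x)) \<le> K * norm x"
proof -
  note bnd = stable_power_bound(1)[OF assms]
  have "\<forall>\<^sub>F t in sequentially. (\<forall>x. norm ((f ^^ t) x) \<le> norm x / 2) \<and> t > 0"
    using stable_power_bound(2)[OF assms] eventually_gt_at_top[of 0] by (rule eventually_conj)
  then obtain N where half: "norm ((f ^^ N) x) \<le> norm x / 2" and N: "N > 0" for x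
    using eventually_happens'[OF sequentially_bot] by blast
  define K where "K = (\<Sum>t<N. \<Sum>b\<in>Basis. norm ((f ^^ t) b))"
  have K0: "K \<ge> 0" unfolding K_def by (intro sum_nonneg) auto
  have KN: "(\<Sum>t<n. norm ((f ^^ t) x)) \<le> K * norm x" if "n \<le> N" for n x
  proof -
    have "(\<Sum>t<n. norm ((f ^^ t) x)) \<le> (\<Sum>t<N. norm ((f ^^ t) x))"
      using that by (intro sum_mono2) auto
    also have "\<dots> \<le> (\<Sum>t<N. (\<Sum>b\<in>Basis. norm ((f ^^ t) b)) * norm x)"
      by (intro sum_mono bnd)
    finally show ?thesis by (simp add: K_def sum_distrib_right)
  qed
  have main: "(\<Sum>t<n. norm ((f ^^ t) x)) \<le> 2 * K * norm x" for n x
  proof (induction n arbitrary: x rule: less_induct)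
    case (less n)
    show ?case
    proof (cases "n \<le> N")
      case True
      have "0 \<le> K * norm x" using K0 by simp
      with KN[OF True, of x] show ?thesis by linarith
    next
      case False
      then have n: "n = N + (n - N)" by simp
      have "(\<Sum>t<n. norm ((f ^^ t) x)) =
          (\<Sum>t<N. norm ((f ^^ t) x)) + (\<Sum>t<n - N. norm ((f ^^ (t + N)) x))"
        by (subst n, subst sum_lessThan_add) simp
      also have "\<dots> = (\<Sum>t<N. norm ((f ^^ t) x)) + (\<Sum>t<n - N. norm ((f ^^ t) ((f ^^ N) x)))"
        by (simp add: funpow_add)
      also have "\<dots> \<le> K * norm x + 2 * K * norm ((f ^^ N) x)"
        using N False by (intro add_mono KN less.IH) auto
      also have "\<dots> \<le> K * norm x + 2 * K * (norm x / 2)"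
        by (intro add_left_mono mult_left_mono half) (use K0 in simp)
      finally show ?thesis by simp
    qed
  qed
  show thesis
  \<comment> \<open>Adding 1 gives \<open>1 \<le> K\<close> at once, so that later divisions by the
    constant are harmless.\<close>
  proof (rule that[of "2 * K + 1"])
    show "(\<Sum>t<n. norm ((f ^^ t) x)) \<le> (2 * K + 1) * norm x" for n x
      using add_increasing2[OF norm_ge_zero main] by (simp add: distrib_right)
  qed (use K0 in simp)
qed

text \<open>The adapted norm is \<open>v x = (\<Sum>t. norm ((f ^^ t) x))\<close>, for which \<open>v (f x) = v x - norm x\<close>.\<close>

lemma stable_adapted_norm:
  fixes f :: "'a::euclidean_space \<Rightarrow> 'a"
  assumes f: "linear f" and lim: "\<And>x. (\<lambda>t. (f ^^ t) x) \<longlonglongrightarrow> 0"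
  obtains v r K where "0 \<le> r" "r < 1" "1 \<le> K"
    "\<And>x. norm x \<le> v x" "\<And>x. v x \<le> K * norm x"
    "\<And>x. v (f x) \<le> r * v x" "\<And>x y. v (x + y) \<le> v x + v y"
proof -
  obtain K where K: "1 \<le> K" "\<And>x n. (\<Sum>t<n. norm ((f ^^ t) x)) \<le> K * norm x"
    by (rule stable_partial_sums[OF assms], rule that)
  note lin = linear_funpow[OF f]
  define v where "v x = (\<Sum>t. norm ((f ^^ t) x))" for x
  have sm: "summable (\<lambda>t. norm ((f ^^ t) x))" for x
    by (rule summableI_nonneg_bounded[OF _ K(2)]) auto
  have vK: "v x \<le> K * norm x" for x
    unfolding v_def by (intro suminf_le_const[OF sm] K)
  have vf: "v (f x) = v x - norm x" for x
    using suminf_split_head[OF sm[of x]] by (simp add: v_def funpow_Suc_right del: funpow.simps)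
  have nv: "norm x \<le> v x" for x
    using sum_le_suminf[OF sm, of "{0}" x] by (simp add: v_def)
  \<comment> \<open>One application of \<open>f\<close> removes the first summand
    \<open>norm x\<close>, which is at least the fraction \<open>1/K\<close> of
    \<open>v x\<close>.\<close>
  have "v (f x) \<le> (1 - 1/K) * v x" for x
  proof -
    have "v x / K \<le> norm x" using vK[of x] K(1) by (simp add: field_simps)
    then show ?thesis by (simp add: vf algebra_simps)
  qed
  moreover have "v (x + y) \<le> v x + v y" for x y
    unfolding v_def suminf_add[OF sm sm]
    by (intro suminf_le[OF _ sm] summable_add sm) (simp add: linear_add[OF lin] norm_triangle_ineq)
  ultimately show thesis
    using K(1) nv vK by (intro that[of "1 - 1/K" K v]) auto
qed

lemma contraction_partial_sums:
  fixes s w :: "nat \<Rightarrow> real"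
  assumes "0 \<le> r" "r < 1" "\<And>t. 0 \<le> s t" "\<And>t. s (Suc t) \<le> r * s t + w t"
  shows "(\<Sum>t<n. s t) \<le> (s 0 + (\<Sum>t<n. w t)) / (1 - r)"
proof -
  have "(1 - r) * (\<Sum>t<n. s t) \<le> s 0 - s n + (\<Sum>t<n. w t)"
  proof (induction n)
    case (Suc n)
    with assms(4)[of n] show ?case by (simp add: algebra_simps)
  qed simp
  with assms(2) assms(3)[of n] show ?thesis by (simp add: field_simps)
qed

text \<open>In the adapted norm the vector recursion becomes the scalar one
  \<open>s (Suc t) \<le> r * s t + K * norm (w t)\<close>. The constant depends on \<open>f\<close>
  alone, not on trajectory, forcing or horizon.\<close>

lemma
  fixes f :: "'a::euclidean_space \<Rightarrow> 'a"
  assumes f: "linear f" and lim: "\<And>x. (\<lambda>t. (f ^^ t) x) \<longlonglongrightarrow> 0"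
  shows stable_recursion_sum:
      "\<exists>K\<ge>0. \<forall>x w n. (\<forall>t. x (Suc t) = f (x t) + w t) \<longrightarrow>
        (\<Sum>t<n. norm (x t)) \<le> K * (norm (x 0) + (\<Sum>t<n. norm (w t)))"
    and stable_recursion_sum_squares:
      "\<exists>K\<ge>0. \<forall>x w n. (\<forall>t. x (Suc t) = f (x t) + w t) \<longrightarrow>
        (\<Sum>t<n. (norm (x t))\<^sup>2) \<le> K * ((norm (x 0))\<^sup>2 + (\<Sum>t<n. (norm (w t))\<^sup>2))"
proof -
  obtain v r K where v: "0 \<le> r" "r < 1" "1 \<le> K"
    "\<And>x. norm x \<le> v x" "\<And>x. v x \<le> K * norm x"
    "\<And>x. v (f x) \<le> r * v x" "\<And>x y. v (x + y) \<le> v x + v y"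
    by (rule stable_adapted_norm[OF assms], rule that)
  have v0: "0 \<le> v x" for x using v(4)[of x] norm_ge_zero[of x] by linarith
  have step: "v (x (Suc t)) \<le> r * v (x t) + K * norm (w t)"
    if "\<And>t. x (Suc t) = f (x t) + w t" for x w and t :: nat
    using v(7)[of "f (x t)" "w t"] v(6)[of "x t"] v(5)[of "w t"] that[of t] by simp
  \<comment> \<open>This is the constant of the squared bound; it dominates the constant
    \<open>K / (1 - r)\<close> of the other one and so serves both.\<close>
  define L where "L = K\<^sup>2 / (1 - r)\<^sup>2"
  have L0: "0 \<le> L" and KL: "K / (1 - r) \<le> L"
  proof -
    show "0 \<le> L" by (simp add: L_def)
    have "K * (1 - r) \<le> K * K" using v by (intro mult_left_mono) auto
    then have "K * (1 - r) / (1 - r)\<^sup>2 \<le> L"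
      unfolding L_def power2_eq_square using v by (intro divide_right_mono) auto
    then show "K / (1 - r) \<le> L" using v by (simp add: power2_eq_square)
  qed
  show "\<exists>K\<ge>0. \<forall>x w n. (\<forall>t. x (Suc t) = f (x t) + w t) \<longrightarrow>
        (\<Sum>t<n. norm (x t)) \<le> K * (norm (x 0) + (\<Sum>t<n. norm (w t)))"
  proof (intro exI[of _ L] conjI L0 allI impI)
    fix x w and n :: nat assume "\<forall>t. x (Suc t) = f (x t) + w t"
    then have rec: "x (Suc t) = f (x t) + w t" for t by blast
    have "(\<Sum>t<n. norm (x t)) \<le> (\<Sum>t<n. v (x t))" by (intro sum_mono v)
    also have "\<dots> \<le> (v (x 0) + (\<Sum>t<n. K * norm (w t))) / (1 - r)"
      by (rule contraction_partial_sums) (use v v0 step[of x w, OF rec] in auto)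
    also have "\<dots> \<le> (K * norm (x 0) + (\<Sum>t<n. K * norm (w t))) / (1 - r)"
      using v by (intro divide_right_mono add_right_mono) auto
    also have "\<dots> = K / (1 - r) * (norm (x 0) + (\<Sum>t<n. norm (w t)))"
      by (simp add: sum_distrib_left[symmetric] distrib_left[symmetric])
    also have "\<dots> \<le> L * (norm (x 0) + (\<Sum>t<n. norm (w t)))"
      by (intro mult_right_mono KL add_nonneg_nonneg sum_nonneg) auto
    finally show "(\<Sum>t<n. norm (x t)) \<le> L * (norm (x 0) + (\<Sum>t<n. norm (w t)))" .
  qed
  show "\<exists>K\<ge>0. \<forall>x w n. (\<forall>t. x (Suc t) = f (x t) + w t) \<longrightarrow>
        (\<Sum>t<n. (norm (x t))\<^sup>2) \<le> K * ((norm (x 0))\<^sup>2 + (\<Sum>t<n. (norm (w t))\<^sup>2))"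
  proof (intro exI[of _ L] conjI L0 allI impI)
    fix x w and n :: nat assume "\<forall>t. x (Suc t) = f (x t) + w t"
    then have rec: "x (Suc t) = f (x t) + w t" for t by blast
    \<comment> \<open>Convexity of the square at weights \<open>r\<close> and \<open>1 - r\<close>,
      applied to \<open>a\<close> and \<open>c / (1 - r)\<close>. It keeps the factor
      \<open>r\<close> in front of the square, where the crude estimate would give
      \<open>2 * r\<^sup>2\<close>.\<close>
    have conv: "(r * a + c)\<^sup>2 \<le> r * a\<^sup>2 + c\<^sup>2 / (1 - r)" for a c :: real
    proof -
      have "(1 - r) * (r * a\<^sup>2 + c\<^sup>2 / (1 - r) - (r * a + c)\<^sup>2) = r * ((1 - r) * a - c)\<^sup>2"
        using v by (simp add: field_simps power2_eq_square)
      also have "\<dots> \<ge> 0" using v by simp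
      finally show ?thesis using v by (simp add: zero_le_mult_iff)
    qed
    have sq: "(v (x (Suc t)))\<^sup>2 \<le> r * (v (x t))\<^sup>2 + (K * norm (w t))\<^sup>2 / (1 - r)" for t
      using power_mono[OF step[of x w t, OF rec] v0, of 2] conv[of "v (x t)" "K * norm (w t)"] by linarith
    have "(\<Sum>t<n. (norm (x t))\<^sup>2) \<le> (\<Sum>t<n. (v (x t))\<^sup>2)"
      by (intro sum_mono power_mono v) auto
    also have "\<dots> \<le> ((v (x 0))\<^sup>2 + (\<Sum>t<n. (K * norm (w t))\<^sup>2 / (1 - r))) / (1 - r)"
      by (rule contraction_partial_sums) (use v sq in auto)
    also have "\<dots> \<le> ((K * norm (x 0))\<^sup>2 / (1 - r) + (\<Sum>t<n. (K * norm (w t))\<^sup>2 / (1 - r))) / (1 - r)"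
    proof (intro divide_right_mono add_right_mono)
      have "(v (x 0))\<^sup>2 \<le> (K * norm (x 0))\<^sup>2" by (intro power_mono v v0)
      also have "\<dots> \<le> (K * norm (x 0))\<^sup>2 / (1 - r)"
        using v mult_left_mono[of "1 - r" 1 "(K * norm (x 0))\<^sup>2"] by (simp add: field_simps)
      finally show "(v (x 0))\<^sup>2 \<le> (K * norm (x 0))\<^sup>2 / (1 - r)" .
    qed (use v in simp)
    also have "\<dots> = L * ((norm (x 0))\<^sup>2 + (\<Sum>t<n. (norm (w t))\<^sup>2))"
      by (simp add: sum_distrib_left sum_divide_distrib L_def power_mult_distrib add_divide_distrib
          distrib_left power2_eq_square mult_ac)
    finally show "(\<Sum>t<n. (norm (x t))\<^sup>2) \<le> L * ((norm (x 0))\<^sup>2 + (\<Sum>t<n. (norm (w t))\<^sup>2))" .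
  qed
qed

section \<open>Second moments\<close>

definition outer :: "real ^ 'n \<Rightarrow> real ^ 'm \<Rightarrow> real ^ 'm ^ 'n" where
  "outer x y = (\<chi> i j. x $ i * y $ j)"

text \<open>On vectorized matrices this is \<open>A \<otimes> A + C \<otimes> C\<close>, the matrix
  whose spectral radius decides mean-square stability.\<close>

definition covariance_op :: "real ^ 'n ^ 'n \<Rightarrow> real ^ 'n ^ 'n \<Rightarrow> real ^ 'n ^ 'n \<Rightarrow> real ^ 'n ^ 'n" where
  "covariance_op A C X = A ** X ** transpose A + C ** X ** transpose C"

lemma linear_covariance_op: "linear (covariance_op A C)"
  by (rule linearI)
     (simp_all add: covariance_op_def vec_eq_iff matrix_matrix_mult_def sum.distrib
        distrib_left distrib_right sum_distrib_left sum_distrib_right mult_ac)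

text \<open>The inner product of matrices is entrywise, that is, the trace of
  \<open>transpose K ** Y\<close>. For symmetric \<open>H\<close> the number
  \<open>H \<bullet> S\<close> is therefore the trace of \<open>H ** S\<close>.\<close>

lemma matrix_inner_mult_left:
  fixes K :: "real ^ 'k ^ 'n" and A :: "real ^ 'm ^ 'n"
  shows "K \<bullet> (A ** Y) = (transpose A ** K) \<bullet> Y"
proof -
  have "K \<bullet> (A ** Y) = (\<Sum>i\<in>UNIV. \<Sum>j\<in>UNIV. \<Sum>k\<in>UNIV. A $ i $ k * K $ i $ j * Y $ k $ j)"
    by (simp add: inner_vec_def matrix_matrix_mult_def sum_distrib_left mult_ac)
  also have "\<dots> = (\<Sum>i\<in>UNIV. \<Sum>k\<in>UNIV. \<Sum>j\<in>UNIV. A $ i $ k * K $ i $ j * Y $ k $ j)"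
    by (intro sum.cong refl sum.swap)
  also have "\<dots> = (\<Sum>k\<in>UNIV. \<Sum>i\<in>UNIV. \<Sum>j\<in>UNIV. A $ i $ k * K $ i $ j * Y $ k $ j)"
    by (rule sum.swap)
  also have "\<dots> = (\<Sum>k\<in>UNIV. \<Sum>j\<in>UNIV. \<Sum>i\<in>UNIV. A $ i $ k * K $ i $ j * Y $ k $ j)"
    by (intro sum.cong refl sum.swap)
  also have "\<dots> = (transpose A ** K) \<bullet> Y"
    by (simp add: inner_vec_def matrix_matrix_mult_def transpose_def sum_distrib_right)
  finally show ?thesis .
qed

lemma matrix_inner_transpose:
  fixes X Y :: "real ^ 'm ^ 'n"
  shows "transpose X \<bullet> transpose Y = X \<bullet> Y"
  unfolding inner_vec_def transpose_def by (simp, rule sum.swap)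

lemma matrix_inner_mult_right:
  fixes K :: "real ^ 'k ^ 'n" and B :: "real ^ 'k ^ 'm"
  shows "K \<bullet> (Y ** B) = (K ** transpose B) \<bullet> Y"
  using matrix_inner_mult_left[of "transpose K" "transpose B" "transpose Y"]
  by (simp add: matrix_transpose_mul[symmetric] matrix_inner_transpose)
     (metis matrix_inner_transpose matrix_transpose_mul transpose_transpose)

lemma matrix_inner_congruence:
  fixes K :: "real ^ 'n ^ 'n" and B :: "real ^ 'm ^ 'n"
  shows "K \<bullet> (B ** X ** transpose B) = (transpose B ** K ** B) \<bullet> X"
  by (subst matrix_inner_mult_right, subst matrix_inner_mult_left) (simp add: matrix_mul_assoc)

text \<open>The adjoint of the covariance map is the operator that appears when \<Theta> is
  eliminated from the two equations for \<open>H\<close>.\<close>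

lemma inner_covariance_op:
  "K \<bullet> covariance_op A C X = (transpose A ** K ** A + transpose C ** K ** C) \<bullet> X"
  by (simp add: covariance_op_def inner_add_left inner_add_right matrix_inner_congruence)

lemma inner_matrix_outer: "Q \<bullet> outer x y = x \<bullet> (Q *v y)"
  by (simp add: inner_vec_def outer_def matrix_vector_mult_def sum_distrib_left mult_ac)

lemma outer_mult: "outer (A *v x) (B *v y) = A ** outer x y ** transpose B"
  by (simp add: vec_eq_iff outer_def matrix_vector_mult_def matrix_matrix_mult_def transpose_def
      sum_product sum_distrib_right sum_distrib_left)
     (simp add: mult_ac)

section \<open>Square-integrable random vectors and their cross moments\<close>

definition sq_integrable :: "'w measure \<Rightarrow> ('w \<Rightarrow> real ^ 'n) \<Rightarrow> bool" where
  "sq_integrable M X \<longleftrightarrow> X \<in> borel_measurable M \<and> integrable M (\<lambda>\<omega>. (norm (X \<omega>))\<^sup>2)"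

text \<open>Two different vectors are allowed because the matrices \<open>outer x x\<close> span
  only the symmetric matrices, whereas decay of the covariance map is wanted on all
  matrices.\<close>

definition cross_moment :: "'w measure \<Rightarrow> ('w \<Rightarrow> real ^ 'n) \<Rightarrow> ('w \<Rightarrow> real ^ 'm) \<Rightarrow> real ^ 'm ^ 'n" where
  "cross_moment M X Y = (\<chi> i j. \<integral>\<omega>. X \<omega> $ i * Y \<omega> $ j \<partial>M)"

lemma borel_measurable_matrix_vector_mult [measurable (raw)]:
  fixes A :: "real ^ 'n ^ 'm"
  assumes "X \<in> borel_measurable M"
  shows "(\<lambda>\<omega>. A *v X \<omega>) \<in> borel_measurable M"
  using assms by (rule measurable_compose)
    (intro borel_measurable_continuous_onI matrix_vector_mult_linear_continuous_on)

lemma borel_measurable_vec_nth [measurable (raw)]: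
  fixes X :: "'w \<Rightarrow> real ^ 'n"
  assumes "X \<in> borel_measurable M"
  shows "(\<lambda>\<omega>. X \<omega> $ i) \<in> borel_measurable M"
  using assms by (rule measurable_compose)
    (intro borel_measurable_continuous_onI continuous_on_component continuous_on_id)

lemma sq_integrable_add:
  fixes X Y :: "'w \<Rightarrow> real ^ 'n"
  assumes "sq_integrable M X" "sq_integrable M Y"
  shows "sq_integrable M (\<lambda>\<omega>. X \<omega> + Y \<omega>)"
  unfolding sq_integrable_def
proof
  have [measurable]: "X \<in> borel_measurable M" "Y \<in> borel_measurable M"
    using assms by (auto simp: sq_integrable_def)
  show "(\<lambda>\<omega>. X \<omega> + Y \<omega>) \<in> borel_measurable M" by measurable
  show "integrable M (\<lambda>\<omega>. (norm (X \<omega> + Y \<omega>))\<^sup>2)"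
  proof (rule Bochner_Integration.integrable_bound)
    show "integrable M (\<lambda>\<omega>. 2 * (norm (X \<omega>))\<^sup>2 + 2 * (norm (Y \<omega>))\<^sup>2)"
      using assms by (auto simp: sq_integrable_def)
    have "(norm (x + y))\<^sup>2 \<le> 2 * (norm x)\<^sup>2 + 2 * (norm y)\<^sup>2" for x y :: "real ^ 'n"
      using power_mono[OF norm_triangle_ineq, of x y 2] sum_squares_bound[of "norm x" "norm y"]
      by (simp add: power2_sum)
    then show "AE \<omega> in M. norm ((norm (X \<omega> + Y \<omega>))\<^sup>2) \<le> norm (2 * (norm (X \<omega>))\<^sup>2 + 2 * (norm (Y \<omega>))\<^sup>2)"
      by auto
  qed measurable
qed

lemma sq_integrable_matrix_vector_mult:
  assumes "sq_integrable M X"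
  shows "sq_integrable M (\<lambda>\<omega>. A *v X \<omega>)"
  unfolding sq_integrable_def
proof
  have [measurable]: "X \<in> borel_measurable M"
    using assms by (auto simp: sq_integrable_def)
  show "(\<lambda>\<omega>. A *v X \<omega>) \<in> borel_measurable M" by measurable
  show "integrable M (\<lambda>\<omega>. (norm (A *v X \<omega>))\<^sup>2)"
  proof (rule Bochner_Integration.integrable_bound)
    show "integrable M (\<lambda>\<omega>. (onorm ((*v) A))\<^sup>2 * (norm (X \<omega>))\<^sup>2)"
      using assms by (auto simp: sq_integrable_def)
    have "(norm (A *v x))\<^sup>2 \<le> (onorm ((*v) A))\<^sup>2 * (norm x)\<^sup>2" for x
      using power_mono[OF onorm[OF matrix_vector_mul_bounded_linear, of A x], of 2]
      by (simp add: power_mult_distrib)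
    then show "AE \<omega> in M. norm ((norm (A *v X \<omega>))\<^sup>2) \<le> norm ((onorm ((*v) A))\<^sup>2 * (norm (X \<omega>))\<^sup>2)"
      by auto
  qed measurable
qed

lemma sq_integrable_scaleR:
  "sq_integrable M X \<Longrightarrow> sq_integrable M (\<lambda>\<omega>. c *\<^sub>R X \<omega>)"
  by (auto simp: sq_integrable_def power_mult_distrib)

lemma (in finite_measure) sq_integrable_const: "sq_integrable M (\<lambda>_. c)"
  by (auto simp: sq_integrable_def)

lemma sq_integrable_diff:
  assumes "sq_integrable M X" "sq_integrable M Y"
  shows "sq_integrable M (\<lambda>\<omega>. X \<omega> - Y \<omega>)"
  using sq_integrable_add[OF assms(1) sq_integrable_scaleR[OF assms(2), of "-1"]] by simp

lemma sq_integrable_mult: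
  fixes X :: "'w \<Rightarrow> real ^ 'n" and Y :: "'w \<Rightarrow> real ^ 'm"
  assumes "sq_integrable M X" "sq_integrable M Y"
  shows "integrable M (\<lambda>\<omega>. X \<omega> $ i * Y \<omega> $ j)"
    "\<bar>cross_moment M X Y $ i $ j\<bar> \<le> (\<integral>\<omega>. (norm (X \<omega>))\<^sup>2 \<partial>M) + (\<integral>\<omega>. (norm (Y \<omega>))\<^sup>2 \<partial>M)"
proof -
  have [measurable]: "X \<in> borel_measurable M" "Y \<in> borel_measurable M"
    using assms by (auto simp: sq_integrable_def)
  have bound: "\<bar>x $ i * y $ j\<bar> \<le> (norm x)\<^sup>2 + (norm y)\<^sup>2" for x :: "real ^ 'n" and y :: "real ^ 'm"
  proof -
    have "\<bar>x $ i * y $ j\<bar> \<le> norm x * norm y"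
      by (simp add: abs_mult mult_mono component_le_norm_cart)
    also have "\<dots> \<le> (norm x)\<^sup>2 + (norm y)\<^sup>2"
      using sum_squares_bound[of "norm x" "norm y"] mult_nonneg_nonneg[OF norm_ge_zero norm_ge_zero, of x y]
      by linarith
    finally show ?thesis .
  qed
  have sm: "integrable M (\<lambda>\<omega>. (norm (X \<omega>))\<^sup>2 + (norm (Y \<omega>))\<^sup>2)"
    using assms by (auto simp: sq_integrable_def)
  show int: "integrable M (\<lambda>\<omega>. X \<omega> $ i * Y \<omega> $ j)"
  proof (rule Bochner_Integration.integrable_bound[OF sm])
    show "AE \<omega> in M. norm (X \<omega> $ i * Y \<omega> $ j) \<le> norm ((norm (X \<omega>))\<^sup>2 + (norm (Y \<omega>))\<^sup>2)"
      using bound by auto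
  qed measurable
  have "\<bar>cross_moment M X Y $ i $ j\<bar> \<le> (\<integral>\<omega>. \<bar>X \<omega> $ i * Y \<omega> $ j\<bar> \<partial>M)"
    unfolding cross_moment_def by simp
  also have "\<dots> \<le> (\<integral>\<omega>. (norm (X \<omega>))\<^sup>2 + (norm (Y \<omega>))\<^sup>2 \<partial>M)"
    by (intro integral_mono sm integrable_abs int bound)
  finally show "\<bar>cross_moment M X Y $ i $ j\<bar> \<le> (\<integral>\<omega>. (norm (X \<omega>))\<^sup>2 \<partial>M) + (\<integral>\<omega>. (norm (Y \<omega>))\<^sup>2 \<partial>M)"
    using assms by (simp add: sq_integrable_def)
qed

lemma (in finite_measure) sq_integrable_nth:
  assumes "sq_integrable M X"
  shows "integrable M (\<lambda>\<omega>. X \<omega> $ i)"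
  \<comment> \<open>The second factor is the constant vector of ones, so its index is
    immaterial.\<close>
  using sq_integrable_mult(1)[OF assms sq_integrable_const[of "\<chi> i. 1"], of i undefined] by simp

lemma (in finite_measure) sq_integrable_integrable:
  assumes "sq_integrable M X"
  shows "integrable M X"
proof (rule Bochner_Integration.integrable_bound)
  show "integrable M (\<lambda>\<omega>. 1 + (norm (X \<omega>))\<^sup>2)" "X \<in> borel_measurable M"
    using assms by (auto simp: sq_integrable_def)
  have "r \<le> 1 + r\<^sup>2" for r :: real
    using sum_squares_bound[of r 1] by (cases "0 \<le> r") (auto intro: order_trans[of r 0])
  then show "AE \<omega> in M. norm (X \<omega>) \<le> norm (1 + (norm (X \<omega>))\<^sup>2)" by auto
qed

lemma integral_vec_nth:
  fixes X :: "'w \<Rightarrow> real ^ 'n"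
  shows "integrable M X \<Longrightarrow> (\<integral>\<omega>. X \<omega> \<partial>M) $ i = (\<integral>\<omega>. X \<omega> $ i \<partial>M)"
  by (rule integral_bounded_linear[OF bounded_linear_vec_nth, symmetric])

lemma cross_moment_mult:
  assumes "sq_integrable M X" "sq_integrable M Y"
  shows "cross_moment M (\<lambda>\<omega>. A *v X \<omega>) (\<lambda>\<omega>. B *v Y \<omega>) = A ** cross_moment M X Y ** transpose B"
  using sq_integrable_mult(1)[OF assms]
  by (simp add: vec_eq_iff cross_moment_def matrix_vector_mult_def matrix_matrix_mult_def transpose_def
      sum_product sum_distrib_right sum_distrib_left mult.assoc mult.left_commute[of _ "B $ _ $ _"])
     (simp add: mult_ac)

lemma cross_moment_add_left:
  assumes "sq_integrable M X" "sq_integrable M X'" "sq_integrable M Y"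
  shows "cross_moment M (\<lambda>\<omega>. X \<omega> + X' \<omega>) Y = cross_moment M X Y + cross_moment M X' Y"
  using sq_integrable_mult(1)[OF assms(1,3)] sq_integrable_mult(1)[OF assms(2,3)]
  by (simp add: vec_eq_iff cross_moment_def distrib_right)

lemma cross_moment_add_right:
  assumes "sq_integrable M X" "sq_integrable M Y" "sq_integrable M Y'"
  shows "cross_moment M X (\<lambda>\<omega>. Y \<omega> + Y' \<omega>) = cross_moment M X Y + cross_moment M X Y'"
  using sq_integrable_mult(1)[OF assms(1,2)] sq_integrable_mult(1)[OF assms(1,3)]
  by (simp add: vec_eq_iff cross_moment_def distrib_left)

lemma (in prob_space) cross_moment_add_const:
  assumes "sq_integrable M X" "expectation X = 0"
  shows "cross_moment M (\<lambda>\<omega>. X \<omega> + c) (\<lambda>\<omega>. X \<omega> + c) = cross_moment M X X + outer c c"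
proof -
  have "expectation (\<lambda>\<omega>. X \<omega> $ i) = 0" for i
    using integral_vec_nth[OF sq_integrable_integrable[OF assms(1)], of i] assms(2) by simp
  then have "cross_moment M X (\<lambda>_. c) = 0" "cross_moment M (\<lambda>_. c) X = 0"
    by (simp_all add: vec_eq_iff cross_moment_def)
  moreover have "cross_moment M (\<lambda>_. c) (\<lambda>_. c) = outer c c"
    by (simp add: vec_eq_iff cross_moment_def outer_def prob_space)
  ultimately show ?thesis
    by (simp add: cross_moment_add_left cross_moment_add_right assms sq_integrable_const sq_integrable_add)
qed

lemma expectation_quadratic_form:
  assumes "sq_integrable M X"
  shows "(\<integral>\<omega>. X \<omega> \<bullet> (Q *v X \<omega>) \<partial>M) = Q \<bullet> cross_moment M X X"
    "integrable M (\<lambda>\<omega>. X \<omega> \<bullet> (Q *v X \<omega>))"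
  using sq_integrable_mult(1)[OF assms assms]
  by (simp_all add: inner_vec_def cross_moment_def matrix_vector_mult_def sum_distrib_left
      mult.left_commute[of _ "Q $ _ $ _"])

text \<open>Nonnegativity of the variance of one coordinate. It lets decay of the mean square pass
  to the mean.\<close>

lemma (in prob_space) power2_expectation_nth_le:
  assumes "sq_integrable M X"
  shows "(expectation X $ i)\<^sup>2 \<le> expectation (\<lambda>\<omega>. (norm (X \<omega>))\<^sup>2)"
proof -
  have X2: "integrable M (\<lambda>\<omega>. (X \<omega> $ i)\<^sup>2)"
    using sq_integrable_mult(1)[OF assms assms, of i i] by (simp add: power2_eq_square)
  have "(expectation (\<lambda>\<omega>. X \<omega> $ i))\<^sup>2 \<le> expectation (\<lambda>\<omega>. (X \<omega> $ i)\<^sup>2)"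
    using variance_eq[OF sq_integrable_nth[OF assms] X2] variance_positive[of "\<lambda>\<omega>. X \<omega> $ i"] by linarith
  also have "\<dots> \<le> expectation (\<lambda>\<omega>. (norm (X \<omega>))\<^sup>2)"
    using assms by (intro integral_mono X2)
      (auto simp: sq_integrable_def abs_le_square_iff[symmetric] component_le_norm_cart)
  finally show ?thesis
    by (simp add: integral_vec_nth[OF sq_integrable_integrable[OF assms]])
qed

section \<open>Systems driven by white noise\<close>

context prob_space
begin

text \<open>The function \<phi> makes one factorization serve both the noise and its square.
  Independence is inherited by the smaller sigma-algebras generated by
  \<open>\<phi> (\<zeta> \<omega>)\<close> and by \<open>h\<close>.\<close>

lemma indep_noise_mult:
  fixes \<zeta> h :: "'a \<Rightarrow> real"
  assumes F: "subalgebra M F'" and h: "h \<in> borel_measurable F'" "integrable M h"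
    and \<zeta>: "\<zeta> \<in> borel_measurable M" "integrable M (\<lambda>\<omega>. \<phi> (\<zeta> \<omega>))" and [measurable]: "\<phi> \<in> borel_measurable borel"
    and ind: "indep_sigma M (vimage_algebra (space M) \<zeta> borel) F'"
  shows "integrable M (\<lambda>\<omega>. \<phi> (\<zeta> \<omega>) * h \<omega>)"
    and "expectation (\<lambda>\<omega>. \<phi> (\<zeta> \<omega>) * h \<omega>) = expectation (\<lambda>\<omega>. \<phi> (\<zeta> \<omega>)) * expectation h"
proof -
  have hM: "h \<in> borel_measurable M"
    using measurable_from_subalg[OF F h(1)] .
  have sub1: "sigma_sets (space M) {(\<lambda>\<omega>. \<phi> (\<zeta> \<omega>)) -` A \<inter> space M | A. A \<in> sets borel}
      \<subseteq> sets (vimage_algebra (space M) \<zeta> borel)"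
  proof -
    have "(\<lambda>\<omega>. \<phi> (\<zeta> \<omega>)) \<in> borel_measurable (vimage_algebra (space M) \<zeta> borel)"
      by (rule measurable_compose[OF measurable_vimage_algebra1]) auto
    from measurable_sets[OF this] show ?thesis
      by (intro sets.sigma_sets_subset[of _ "vimage_algebra (space M) \<zeta> borel", simplified]) auto
  qed
  have sub2: "sigma_sets (space M) {h -` A \<inter> space M | A. A \<in> sets borel} \<subseteq> sets F'"
  proof -
    have sp: "space F' = space M" using F by (simp add: subalgebra_def)
    show ?thesis using measurable_sets[OF h(1)] unfolding sp[symmetric]
      by (intro sets.sigma_sets_subset) auto
  qed
  have "indep_var borel (\<lambda>\<omega>. \<phi> (\<zeta> \<omega>)) borel h"
    unfolding indep_var_eq
  proof (intro conjI)
    show "indep_set (sigma_sets (space M) {(\<lambda>\<omega>. \<phi> (\<zeta> \<omega>)) -` A \<inter> space M | A. A \<in> sets borel})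
        (sigma_sets (space M) {h -` A \<inter> space M | A. A \<in> sets borel})"
      using ind sub1 sub2 unfolding indep_sigma_def indep_sets2_eq by blast
  qed (use hM \<zeta>(1) in measurable)
  note iv = this
  show "integrable M (\<lambda>\<omega>. \<phi> (\<zeta> \<omega>) * h \<omega>)"
    by (rule indep_var_integrable[OF iv \<zeta>(2) h(2)])
  show "expectation (\<lambda>\<omega>. \<phi> (\<zeta> \<omega>) * h \<omega>) = expectation (\<lambda>\<omega>. \<phi> (\<zeta> \<omega>)) * expectation h"
    by (rule indep_var_lebesgue_integral[OF iv \<zeta>(2) h(2)])
qed

text \<open>One time step in abstract form: \<open>p\<close> and \<open>q\<close> are known before
  the noise \<zeta> arrives. Terms linear in \<zeta> vanish because its mean is zero, and the
  quadratic term survives with factor 1. In the cross moment both vectors see the same \<zeta>,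
  which is why \<open>q\<close> and \<open>q'\<close> contribute.\<close>

lemma noise_step:
  fixes p q :: "'a \<Rightarrow> real ^ 'n" and \<zeta> :: "'a \<Rightarrow> real"
  assumes F: "subalgebra M F'"
    and \<zeta>: "\<zeta> \<in> borel_measurable M" "integrable M \<zeta>" "integrable M (\<lambda>\<omega>. (\<zeta> \<omega>)\<^sup>2)"
      "expectation \<zeta> = 0" "variance \<zeta> = 1"
    and ind: "indep_sigma M (vimage_algebra (space M) \<zeta> borel) F'"
    and p: "p \<in> borel_measurable F'" "sq_integrable M p"
    and q: "q \<in> borel_measurable F'" "sq_integrable M q"
  shows "sq_integrable M (\<lambda>\<omega>. p \<omega> + \<zeta> \<omega> *\<^sub>R q \<omega>)"
    and "expectation (\<lambda>\<omega>. p \<omega> + \<zeta> \<omega> *\<^sub>R q \<omega>) = expectation p"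
    and "\<And>p' q' :: 'a \<Rightarrow> real ^ 'm. p' \<in> borel_measurable F' \<Longrightarrow> sq_integrable M p' \<Longrightarrow>
      q' \<in> borel_measurable F' \<Longrightarrow> sq_integrable M q' \<Longrightarrow>
      cross_moment M (\<lambda>\<omega>. p \<omega> + \<zeta> \<omega> *\<^sub>R q \<omega>) (\<lambda>\<omega>. p' \<omega> + \<zeta> \<omega> *\<^sub>R q' \<omega>)
        = cross_moment M p p' + cross_moment M q q'"
proof -
  have var: "expectation (\<lambda>\<omega>. (\<zeta> \<omega>)\<^sup>2) = 1"
    using \<zeta> by simp
  note lin = indep_noise_mult[OF F _ _ \<zeta>(1) _ _ ind, of _ "\<lambda>x. x", simplified \<zeta>(4) mult_zero_left]
  note quad = indep_noise_mult[OF F _ _ \<zeta>(1) _ _ ind, of _ "\<lambda>x. x\<^sup>2", simplified var mult_1]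
  have qM [measurable]: "q \<in> borel_measurable M"
    using q(2) by (simp add: sq_integrable_def)
  have \<zeta>q: "sq_integrable M (\<lambda>\<omega>. \<zeta> \<omega> *\<^sub>R q \<omega>)"
    unfolding sq_integrable_def
  proof
    show "(\<lambda>\<omega>. \<zeta> \<omega> *\<^sub>R q \<omega>) \<in> borel_measurable M"
      using \<zeta>(1) by measurable
    show "integrable M (\<lambda>\<omega>. (norm (\<zeta> \<omega> *\<^sub>R q \<omega>))\<^sup>2)"
      using quad(1)[of "\<lambda>\<omega>. (norm (q \<omega>))\<^sup>2"] q \<zeta>(3)
      by (simp add: power_mult_distrib sq_integrable_def)
  qed
  show pq: "sq_integrable M (\<lambda>\<omega>. p \<omega> + \<zeta> \<omega> *\<^sub>R q \<omega>)"
    by (rule sq_integrable_add[OF p(2) \<zeta>q])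
  show "expectation (\<lambda>\<omega>. p \<omega> + \<zeta> \<omega> *\<^sub>R q \<omega>) = expectation p"
  proof -
    have "expectation (\<lambda>\<omega>. \<zeta> \<omega> * q \<omega> $ i) = 0" for i
      by (rule lin(2)) (use q \<zeta>(2) sq_integrable_nth[OF q(2)] in measurable)
    then have "expectation (\<lambda>\<omega>. \<zeta> \<omega> *\<^sub>R q \<omega>) = 0"
      by (simp add: vec_eq_iff integral_vec_nth[OF sq_integrable_integrable[OF \<zeta>q]])
    then show ?thesis
      by (simp add: sq_integrable_integrable \<zeta>q p(2))
  qed
  fix p' q' :: "'a \<Rightarrow> real ^ 'm"
  assume p': "p' \<in> borel_measurable F'" "sq_integrable M p'"
    and q': "q' \<in> borel_measurable F'" "sq_integrable M q'"
  have "(\<integral>\<omega>. (p \<omega> + \<zeta> \<omega> *\<^sub>R q \<omega>) $ i * (p' \<omega> + \<zeta> \<omega> *\<^sub>R q' \<omega>) $ j \<partial>M)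
      = (\<integral>\<omega>. p \<omega> $ i * p' \<omega> $ j \<partial>M) + (\<integral>\<omega>. q \<omega> $ i * q' \<omega> $ j \<partial>M)" for i j
  proof -
    have m: "(\<lambda>\<omega>. p \<omega> $ i * q' \<omega> $ j + q \<omega> $ i * p' \<omega> $ j) \<in> borel_measurable F'"
      "(\<lambda>\<omega>. q \<omega> $ i * q' \<omega> $ j) \<in> borel_measurable F'"
      using p(1) q(1) p'(1) q'(1) by measurable
    note int = sq_integrable_mult(1)[OF p(2) p'(2), of i j] sq_integrable_mult(1)[OF q(2) q'(2), of i j]
      sq_integrable_mult(1)[OF p(2) q'(2), of i j] sq_integrable_mult(1)[OF q(2) p'(2), of i j]
    note L = lin[OF m(1) Bochner_Integration.integrable_add[OF int(3,4)] \<zeta>(2), simplified]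
      quad[OF m(2) int(2) \<zeta>(3), simplified]
    have "(\<integral>\<omega>. (p \<omega> + \<zeta> \<omega> *\<^sub>R q \<omega>) $ i * (p' \<omega> + \<zeta> \<omega> *\<^sub>R q' \<omega>) $ j \<partial>M)
      = (\<integral>\<omega>. p \<omega> $ i * p' \<omega> $ j + (\<zeta> \<omega> * (p \<omega> $ i * q' \<omega> $ j + q \<omega> $ i * p' \<omega> $ j)
          + (\<zeta> \<omega>)\<^sup>2 * (q \<omega> $ i * q' \<omega> $ j)) \<partial>M)"
      by (simp add: algebra_simps power2_eq_square)
    also have "\<dots> = (\<integral>\<omega>. p \<omega> $ i * p' \<omega> $ j \<partial>M) + (\<integral>\<omega>. q \<omega> $ i * q' \<omega> $ j \<partial>M)"
      using L int(1) by simp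
    finally show ?thesis .
  qed
  then show "cross_moment M (\<lambda>\<omega>. p \<omega> + \<zeta> \<omega> *\<^sub>R q \<omega>) (\<lambda>\<omega>. p' \<omega> + \<zeta> \<omega> *\<^sub>R q' \<omega>)
        = cross_moment M p p' + cross_moment M q q'"
    by (simp add: cross_moment_def vec_eq_iff)
qed

end

locale noisy_filtration = prob_space M for M :: "'w measure" +
  fixes F :: "nat \<Rightarrow> 'w measure" and \<xi> :: "nat \<Rightarrow> 'w \<Rightarrow> real"
  assumes filtration: "filtration (space M) F"
    and subalgebra: "\<And>t. subalgebra M (F t)"
    and white_noise: "white_noise M F \<xi>"
begin

lemma noise_measurable: "\<xi> t \<in> borel_measurable M"
  using white_noise measurable_from_subalg[OF subalgebra] by (auto simp: white_noise_def)

lemma white_noiseD: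
  "integrable M (\<xi> t)" "integrable M (\<lambda>\<omega>. (\<xi> t \<omega>)\<^sup>2)" "expectation (\<xi> t) = 0" "variance (\<xi> t) = 1"
  "indep_sigma M (vimage_algebra (space M) (\<xi> (Suc t)) borel) (F t)"
  "\<xi> t \<in> borel_measurable (F t)"
  using white_noise unfolding white_noise_def by blast+

lemmas white_noise_moments =
  noise_step[OF subalgebra noise_measurable white_noiseD(1-5)]

lemma F_Suc: "f \<in> borel_measurable (F t) \<Longrightarrow> f \<in> borel_measurable (F (Suc t))"
  using filtration subalgebra
  by (intro measurable_from_subalg[of "F (Suc t)" "F t"])
     (auto simp: filtration_def subalgebra_def)

lemma state_adapted:
  assumes "x0 \<in> borel_measurable (F 0)" "sq_integrable M x0"
  shows "state A b C \<xi> x0 u t \<in> borel_measurable (F t)" and "sq_integrable M (state A b C \<xi> x0 u t)"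
proof -
  have "state A b C \<xi> x0 u t \<in> borel_measurable (F t) \<and> sq_integrable M (state A b C \<xi> x0 u t)"
  proof (induction t)
    case (Suc t)
    have [measurable]: "state A b C \<xi> x0 u t \<in> borel_measurable (F t)"
      "state A b C \<xi> x0 u t \<in> borel_measurable (F (Suc t))" "\<xi> (Suc t) \<in> borel_measurable (F (Suc t))"
      using Suc F_Suc white_noiseD by auto
    have "(\<lambda>\<omega>. A *v state A b C \<xi> x0 u t \<omega> + b *v u t) \<in> borel_measurable (F t)"
      "(\<lambda>\<omega>. C *v state A b C \<xi> x0 u t \<omega>) \<in> borel_measurable (F t)"
      by measurable
    moreover have "sq_integrable M (state A b C \<xi> x0 u (Suc t))"
      unfolding state.simps
      by (intro white_noise_moments(1) calculation sq_integrable_add sq_integrable_matrix_vector_mult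
          sq_integrable_const) (use Suc in auto)
    moreover have "state A b C \<xi> x0 u (Suc t) \<in> borel_measurable (F (Suc t))"
      unfolding state.simps by measurable
    ultimately show ?case by simp
  qed (use assms in simp)
  then show "state A b C \<xi> x0 u t \<in> borel_measurable (F t)" "sq_integrable M (state A b C \<xi> x0 u t)"
    by auto
qed

text \<open>The noise of the next step multiplies an \<open>F t\<close>-measurable vector and has
  mean zero, so only the drift survives.\<close>

lemma expectation_state:
  assumes "x0 \<in> borel_measurable (F 0)" "sq_integrable M x0"
  shows "expectation (state A b C \<xi> x0 u t) = det_state A b (expectation x0) u t"
proof (induction t)
  case (Suc t)
  note S = state_adapted[OF assms, of A b C u t]
  have [measurable]: "state A b C \<xi> x0 u t \<in> borel_measurable (F t)" by (rule S)
  have "expectation (state A b C \<xi> x0 u (Suc t)) = expectation (\<lambda>\<omega>. A *v state A b C \<xi> x0 u t \<omega> + b *v u t)"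
    unfolding state.simps
    by (rule white_noise_moments(2))
       (use S in \<open>simp_all add: sq_integrable_add sq_integrable_matrix_vector_mult sq_integrable_const\<close>)
  also have "\<dots> = A *v expectation (state A b C \<xi> x0 u t) + b *v u t"
    by (simp add: sq_integrable_integrable[OF sq_integrable_matrix_vector_mult] S prob_space
      integral_bounded_linear[OF matrix_vector_mul_bounded_linear] sq_integrable_integrable)
  finally show ?case using Suc by simp
qed simp

lemma cross_moment_uncontrolled:
  assumes "x0 \<in> borel_measurable (F 0)" "sq_integrable M x0"
    and "x0' \<in> borel_measurable (F 0)" "sq_integrable M x0'"
  shows "cross_moment M (state A b C \<xi> x0 (\<lambda>_. 0) t) (state A b C \<xi> x0' (\<lambda>_. 0) t)
    = (covariance_op A C ^^ t) (cross_moment M x0 x0')"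
proof (induction t)
  case (Suc t)
  note S = state_adapted[OF assms(1,2), of A b C "\<lambda>_. 0" t]
  note S' = state_adapted[OF assms(3,4), of A b C "\<lambda>_. 0" t]
  have "cross_moment M (state A b C \<xi> x0 (\<lambda>_. 0) (Suc t)) (state A b C \<xi> x0' (\<lambda>_. 0) (Suc t))
    = cross_moment M (\<lambda>\<omega>. A *v state A b C \<xi> x0 (\<lambda>_. 0) t \<omega>) (\<lambda>\<omega>. A *v state A b C \<xi> x0' (\<lambda>_. 0) t \<omega>)
    + cross_moment M (\<lambda>\<omega>. C *v state A b C \<xi> x0 (\<lambda>_. 0) t \<omega>) (\<lambda>\<omega>. C *v state A b C \<xi> x0' (\<lambda>_. 0) t \<omega>)"
    by (simp, rule white_noise_moments(3))
       (use S S' in \<open>simp_all add: sq_integrable_matrix_vector_mult borel_measurable_matrix_vector_mult\<close>)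
  then show ?case
    using Suc S S' by (simp add: cross_moment_mult covariance_op_def)
qed simp

text \<open>Centering removes the control, which is deterministic. The noise, however, multiplies
  the uncentered state, whose second moment is \<open>S t\<close> plus the square of the mean; this
  is the origin of the forcing term \<open>outer (C *v y t) (C *v y t)\<close>.\<close>

lemma covariance_state:
  fixes A C :: "real ^ 'n ^ 'n" and b :: "real ^ 'm ^ 'n" and u :: "nat \<Rightarrow> real ^ 'm"
  assumes "x0 \<in> borel_measurable (F 0)" "sq_integrable M x0"
  defines "x \<equiv> state A b C \<xi> x0 u" and "y \<equiv> det_state A b (expectation x0) u"
  defines "S \<equiv> \<lambda>t. cross_moment M (\<lambda>\<omega>. x t \<omega> - y t) (\<lambda>\<omega>. x t \<omega> - y t)"
  shows "cross_moment M (x t) (x t) = S t + outer (y t) (y t)"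
    and "S (Suc t) = covariance_op A C (S t) + outer (C *v y t) (C *v y t)"
proof -
  have X: "x t \<in> borel_measurable (F t)" "sq_integrable M (x t)"
    and E: "expectation (x t) = y t" for t
    using state_adapted[OF assms(1,2)] expectation_state[OF assms(1,2)] by (simp_all add: x_def y_def)
  have sq: "sq_integrable M (\<lambda>\<omega>. x t \<omega> - y t)" for t
    by (intro sq_integrable_diff X sq_integrable_const)
  have "expectation (\<lambda>\<omega>. x t \<omega> - y t) = 0" for t
    by (simp add: sq_integrable_integrable X E prob_space)
  note zero = this
  have P: "cross_moment M (x t) (x t) = S t + outer (y t) (y t)" for t
    using cross_moment_add_const[OF sq[of t] zero, of "y t"] by (simp add: S_def)
  then show "cross_moment M (x t) (x t) = S t + outer (y t) (y t)" .
  have "(\<lambda>\<omega>. x (Suc t) \<omega> - y (Suc t)) = (\<lambda>\<omega>. A *v (x t \<omega> - y t) + \<xi> (Suc t) \<omega> *\<^sub>R (C *v x t \<omega>))"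
    by (simp add: x_def y_def algebra_simps)
  then have "S (Suc t) = cross_moment M (\<lambda>\<omega>. A *v (x t \<omega> - y t)) (\<lambda>\<omega>. A *v (x t \<omega> - y t))
      + cross_moment M (\<lambda>\<omega>. C *v x t \<omega>) (\<lambda>\<omega>. C *v x t \<omega>)"
    unfolding S_def
    by (simp, intro white_noise_moments(3) sq_integrable_matrix_vector_mult sq
        borel_measurable_matrix_vector_mult borel_measurable_diff X borel_measurable_const)
  also have "\<dots> = A ** S t ** transpose A + C ** cross_moment M (x t) (x t) ** transpose C"
    by (simp add: cross_moment_mult sq X S_def)
  finally show "S (Suc t) = covariance_op A C (S t) + outer (C *v y t) (C *v y t)"
    by (simp add: P covariance_op_def outer_mult matrix_add_ldistrib)
       (simp add: vec_eq_iff matrix_matrix_mult_def distrib_right sum.distrib)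
qed

text \<open>A constant generates the trivial sigma-algebra, whose events have probability 0 or 1 and
  are independent of everything. This makes stability applicable to every deterministic
  start.\<close>

lemma admissible_init_const: "admissible_init M F \<xi> (\<lambda>_. c)"
proof -
  let ?N = "vimage_algebra (space M) (\<lambda>\<omega> t. \<xi> t \<omega>) (Pi\<^sub>M UNIV (\<lambda>_. borel))"
  have N: "sets ?N \<subseteq> events"
    by (rule sets_image_in_sets) (auto intro!: measurable_PiM_single' noise_measurable)
  have "sets (vimage_algebra (space M) (\<lambda>_. c) borel) \<subseteq> {{}, space M}"
    by (subst sets_vimage_algebra2) auto
  then have c: "B = {} \<or> B = space M" if "B \<in> sets (vimage_algebra (space M) (\<lambda>_. c) borel)" for B
    using that by blast
  have "indep_sigma M (vimage_algebra (space M) (\<lambda>_. c) borel) ?N"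
    unfolding indep_sigma_def indep_sets2_eq
  proof (intro conjI ballI N subsetI)
    show "B \<in> events" if "B \<in> sets (vimage_algebra (space M) (\<lambda>_. c) borel)" for B
      using c[OF that] by auto
    show "prob (B \<inter> D) = prob B * prob D"
      if "B \<in> sets (vimage_algebra (space M) (\<lambda>_. c) borel)" "D \<in> sets ?N" for B D
      using c[OF that(1)] N that(2) sets.Int_space_eq1[of D] by (auto simp: prob_space)
  qed
  then show ?thesis by (simp add: admissible_init_def)
qed

end

section \<open>Comparison of the two costs\<close>

lemma norm_outer: "norm (outer x y) = norm x * norm y"
proof -
  have "outer x y $ i = x $ i *\<^sub>R y" for i
    by (simp add: outer_def vec_eq_iff)
  then show ?thesis
    by (simp add: norm_vec_def[of "outer x y"] norm_vec_def[of x] L2_set_left_distrib)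
qed

text \<open>The polar form of the running cost on pairs of state and control. The two mixed terms
  are placed so that it is symmetric whenever \<open>Q\<close> and \<Gamma> are.\<close>

definition cost_bilinear ::
  "real ^ 'n ^ 'n \<Rightarrow> real ^ 'm ^ 'n \<Rightarrow> real ^ 'm ^ 'm
    \<Rightarrow> (real ^ 'n) \<times> (real ^ 'm) \<Rightarrow> (real ^ 'n) \<times> (real ^ 'm) \<Rightarrow> real" where
  "cost_bilinear Q \<gamma> \<Gamma> z z' = fst z \<bullet> (Q *v fst z') + fst z \<bullet> (\<gamma> *v snd z') + fst z' \<bullet> (\<gamma> *v snd z)
     + snd z \<bullet> (\<Gamma> *v snd z')"

lemma bounded_bilinear_cost_bilinear: "bounded_bilinear (cost_bilinear Q \<gamma> \<Gamma>)"
  unfolding bilinear_conv_bounded_bilinear[symmetric] bilinear_def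
  by (intro conjI allI linearI)
     (simp_all add: cost_bilinear_def inner_add_left inner_add_right matrix_vector_right_distrib
       matrix_vector_mult_scaleR distrib_left)

lemma cost_bilinear_commute:
  assumes "transpose Q = Q" "transpose \<Gamma> = \<Gamma>"
  shows "cost_bilinear Q \<gamma> \<Gamma> z z' = cost_bilinear Q \<gamma> \<Gamma> z' z"
proof -
  have "x \<bullet> (P *v y) = y \<bullet> (P *v x)" if "transpose P = P" for P :: "real ^ 'k ^ 'k" and x y
    using dot_lmul_matrix[of x P y] that vector_transpose_matrix[of x P] by (simp add: inner_commute)
  from this[OF assms(1)] this[OF assms(2)] show ?thesis by (simp add: cost_bilinear_def)
qed

definition cost :: "real ^ 'n ^ 'n \<Rightarrow> real ^ 'm ^ 'n \<Rightarrow> real ^ 'm ^ 'm \<Rightarrow> real ^ 'n \<Rightarrow> real ^ 'm \<Rightarrow> real" where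
  "cost Q \<gamma> \<Gamma> x u = x \<bullet> (Q *v x) + 2 * (x \<bullet> (\<gamma> *v u)) + u \<bullet> (\<Gamma> *v u)"

lemma cost_eq_bilinear: "cost Q \<gamma> \<Gamma> x u = cost_bilinear Q \<gamma> \<Gamma> (x, u) (x, u)"
  by (simp add: cost_def cost_bilinear_def)

lemma det_state_uncontrolled: "det_state A b x (\<lambda>_. 0) t = ((*v) A ^^ t) x"
  by (induction t) simp_all

text \<open>The constant precedes the initial state, the control and the horizon. Summability needs
  only a bound for each trajectory, but the estimate of the linear part of the cost needs one
  constant for all controls.\<close>

lemma det_state_energy:
  fixes A :: "real ^ 'n ^ 'n" and b :: "real ^ 'm ^ 'n"
  assumes A: "\<And>x. (\<lambda>t. ((*v) A ^^ t) x) \<longlonglongrightarrow> 0"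
  shows "\<exists>K\<ge>0. \<forall>y0. \<forall>u\<in>controls. \<forall>n.
    (\<Sum>t<n. (norm (det_state A b y0 u t))\<^sup>2) \<le> K * ((norm y0)\<^sup>2 + (\<Sum>t. (norm (u t))\<^sup>2))"
proof -
  obtain K where K: "0 \<le> K"
    "\<forall>x w n. (\<forall>t. x (Suc t) = A *v x t + w t) \<longrightarrow>
      (\<Sum>t<n. (norm (x t))\<^sup>2) \<le> K * ((norm (x 0))\<^sup>2 + (\<Sum>t<n. (norm (w t))\<^sup>2))"
    using stable_recursion_sum_squares[OF matrix_vector_mul_linear A] by blast
  define c where "c = (onorm ((*v) b))\<^sup>2"
  have bound: "(\<Sum>t<n. (norm (det_state A b y0 u t))\<^sup>2) \<le> K * (1 + c) * ((norm y0)\<^sup>2 + (\<Sum>t. (norm (u t))\<^sup>2))"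
    if u: "u \<in> controls" for y0 u n
  proof -
    have u2: "summable (\<lambda>t. (norm (u t))\<^sup>2)" using u by (simp add: controls_def)
    have "(\<Sum>t<n. (norm (b *v u t))\<^sup>2) \<le> (\<Sum>t<n. c * (norm (u t))\<^sup>2)"
      using power_mono[OF onorm[OF matrix_vector_mul_bounded_linear, of b], of _ 2]
      by (intro sum_mono) (simp add: power_mult_distrib c_def)
    also have "\<dots> \<le> c * (\<Sum>t. (norm (u t))\<^sup>2)"
      unfolding sum_distrib_left[symmetric] c_def by (intro mult_left_mono sum_le_suminf u2) auto
    finally have "(norm y0)\<^sup>2 + (\<Sum>t<n. (norm (b *v u t))\<^sup>2) \<le> (norm y0)\<^sup>2 + c * (\<Sum>t. (norm (u t))\<^sup>2)"
      by simp
    also have "\<dots> \<le> (1 + c) * ((norm y0)\<^sup>2 + (\<Sum>t. (norm (u t))\<^sup>2))"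
      using suminf_nonneg[OF u2] by (simp add: distrib_left distrib_right c_def)
    finally have "K * ((norm y0)\<^sup>2 + (\<Sum>t<n. (norm (b *v u t))\<^sup>2))
        \<le> K * ((1 + c) * ((norm y0)\<^sup>2 + (\<Sum>t. (norm (u t))\<^sup>2)))"
      by (rule mult_left_mono[OF _ K(1)])
    then show ?thesis
      using K(2)[rule_format, of "det_state A b y0 u" "\<lambda>t. b *v u t" n] by (simp add: mult.assoc)
  qed
  have "0 \<le> K * (1 + c)" using K(1) by (simp add: c_def)
  with bound show ?thesis by blast
qed

lemma det_state_summable:
  fixes A :: "real ^ 'n ^ 'n" and b :: "real ^ 'm ^ 'n"
  assumes A: "\<And>x. (\<lambda>t. ((*v) A ^^ t) x) \<longlonglongrightarrow> 0" and u: "u \<in> controls"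
  shows "summable (\<lambda>t. (norm (det_state A b y0 u t))\<^sup>2)"
proof -
  obtain K where "(\<Sum>t<n. (norm (det_state A b y0 u t))\<^sup>2) \<le> K * ((norm y0)\<^sup>2 + (\<Sum>t. (norm (u t))\<^sup>2))" for n
    using det_state_energy[OF A, of b] u by blast
  then show ?thesis by (intro summableI_nonneg_bounded) auto
qed

lemma summable_bilinear:
  assumes "bounded_bilinear B"
    and p: "summable (\<lambda>t. (norm (p t))\<^sup>2)" and q: "summable (\<lambda>t. (norm (q t))\<^sup>2)"
  shows "summable (\<lambda>t. B (p t) (q t) :: real)"
proof -
  obtain K where K: "0 \<le> K" "\<And>x y. norm (B x y) \<le> norm x * norm y * K"
    using bounded_bilinear.nonneg_bounded[OF assms(1)] by blast
  show ?thesis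
  proof (rule summable_comparison_test')
    show "summable (\<lambda>t. ((norm (p t))\<^sup>2 + (norm (q t))\<^sup>2) * K)"
      by (intro summable_mult2 summable_add p q)
    fix t
    have "norm (p t) * norm (q t) \<le> (norm (p t))\<^sup>2 + (norm (q t))\<^sup>2"
      using sum_squares_bound[of "norm (p t)" "norm (q t)"]
        mult_nonneg_nonneg[OF norm_ge_zero norm_ge_zero, of "p t" "q t"] by linarith
    from mult_right_mono[OF this K(1)] K(2)[of "p t" "q t"]
    show "norm (B (p t) (q t)) \<le> ((norm (p t))\<^sup>2 + (norm (q t))\<^sup>2) * K" by linarith
  qed
qed

lemma summable_pair:
  assumes "summable (\<lambda>t. (norm (x t))\<^sup>2)" "summable (\<lambda>t. (norm (u t))\<^sup>2)"
  shows "summable (\<lambda>t. (norm (x t, u t))\<^sup>2)"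
  using summable_add[OF assms] by (simp add: norm_Pair)

lemma summable_cost:
  assumes "summable (\<lambda>t. (norm (x t))\<^sup>2)" "summable (\<lambda>t. (norm (u t))\<^sup>2)"
  shows "summable (\<lambda>t. cost Q \<gamma> \<Gamma> (x t) (u t))"
  unfolding cost_eq_bilinear
  by (rule summable_bilinear[OF bounded_bilinear_cost_bilinear summable_pair summable_pair]) (rule assms)+

context noisy_filtration
begin

section \<open>Consequences of mean-square stability\<close>

context
  fixes A C :: "real ^ 'n ^ 'n" and b :: "real ^ 'm ^ 'n"
  assumes stable: "mean_square_stable M F \<xi> A b C"
begin

lemma stable_const:
  "(\<lambda>t. expectation (\<lambda>\<omega>. (norm (state A b C \<xi> (\<lambda>_. x) (\<lambda>_. 0) t \<omega>))\<^sup>2)) \<longlonglongrightarrow> 0"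
  by (rule stable[unfolded mean_square_stable_def, rule_format, OF admissible_init_const])

text \<open>Two uncontrolled trajectories driven by the same noise, started at \<open>x\<close> and \<open>y\<close>, have
  cross moment \<open>(covariance_op A C ^^ t) (outer x y)\<close>.\<close>

lemma covariance_op_power_tendsto_0: "(\<lambda>t. (covariance_op A C ^^ t) X) \<longlonglongrightarrow> 0"
proof -
  have out: "(\<lambda>t. (covariance_op A C ^^ t) (outer x y)) \<longlonglongrightarrow> 0" for x y :: "real ^ 'n"
  proof (intro vec_tendstoI)
    fix i j
    let ?x = "state A b C \<xi> (\<lambda>_. x) (\<lambda>_. 0)" and ?y = "state A b C \<xi> (\<lambda>_. y) (\<lambda>_. 0)"
    note sq = state_adapted(2)[OF borel_measurable_const sq_integrable_const]
    have "cross_moment M (\<lambda>_. x) (\<lambda>_. y) = outer x y"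
      by (simp add: vec_eq_iff cross_moment_def outer_def prob_space)
    then have eq: "(covariance_op A C ^^ t) (outer x y) = cross_moment M (?x t) (?y t)" for t
      using cross_moment_uncontrolled[of "\<lambda>_. x" "\<lambda>_. y" A b C t] by (simp add: sq_integrable_const)
    \<comment> \<open>Each entry of the cross moment is dominated by the sum of the two mean
      squares, and these vanish by stability.\<close>
    have "(\<lambda>t. expectation (\<lambda>\<omega>. (norm (?x t \<omega>))\<^sup>2) + expectation (\<lambda>\<omega>. (norm (?y t \<omega>))\<^sup>2)) \<longlonglongrightarrow> 0"
      using tendsto_add[OF stable_const stable_const, of x y] by simp
    then have "(\<lambda>t. cross_moment M (?x t) (?y t) $ i $ j) \<longlonglongrightarrow> 0"
      by (rule Lim_null_comparison[rotated])
         (intro always_eventually allI, unfold real_norm_def, rule sq_integrable_mult(2)[OF sq sq])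
    then show "(\<lambda>t. (covariance_op A C ^^ t) (outer x y) $ i $ j) \<longlonglongrightarrow> 0 $ i $ j"
      by (simp add: eq)
  qed
  \<comment> \<open>The standard basis of the matrix space consists of rank-one matrices, so
    linearity extends the decay to every \<open>X\<close>.\<close>
  have "(\<lambda>t. \<Sum>B\<in>Basis. (X \<bullet> B) *\<^sub>R (covariance_op A C ^^ t) B) \<longlonglongrightarrow> (\<Sum>B\<in>(Basis :: (real ^ 'n ^ 'n) set). (X \<bullet> B) *\<^sub>R 0)"
  proof (intro tendsto_sum tendsto_scaleR tendsto_const)
    fix B :: "real ^ 'n ^ 'n" assume "B \<in> Basis"
    then obtain i j where "B = axis i (axis j 1)" by (auto simp: Basis_vec_def)
    then have "B = outer (axis i 1) (axis j 1)"
      by (auto simp: vec_eq_iff outer_def axis_def)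
    then show "(\<lambda>t. (covariance_op A C ^^ t) B) \<longlonglongrightarrow> 0" using out by simp
  qed
  moreover have "(covariance_op A C ^^ t) X = (\<Sum>B\<in>Basis. (X \<bullet> B) *\<^sub>R (covariance_op A C ^^ t) B)" for t
  proof -
    note lin = linear_funpow[OF linear_covariance_op[of A C], of t]
    have "(covariance_op A C ^^ t) X = (covariance_op A C ^^ t) (\<Sum>B\<in>Basis. (X \<bullet> B) *\<^sub>R B)"
      by (simp add: euclidean_representation)
    then show ?thesis by (simp add: linear_sum[OF lin] linear_scale[OF lin])
  qed
  ultimately show ?thesis by simp
qed

text \<open>The orbit of \<open>A\<close> is the mean of the uncontrolled state, and the mean is
  dominated by the mean square.\<close>

lemma matrix_power_tendsto_0: "(\<lambda>t. ((*v) A ^^ t) x) \<longlonglongrightarrow> 0"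
proof (rule vec_tendstoI)
  fix i
  let ?x = "state A b C \<xi> (\<lambda>_. x) (\<lambda>_. 0)"
  have sq: "sq_integrable M (?x t)" for t
    by (intro state_adapted) (simp_all add: sq_integrable_const)
  have "expectation (?x t) = ((*v) A ^^ t) x" for t
    using expectation_state[of "\<lambda>_. x" A b C "\<lambda>_. 0" t] by (simp add: sq_integrable_const prob_space det_state_uncontrolled)
  then have le: "((((*v) A ^^ t) x) $ i)\<^sup>2 \<le> expectation (\<lambda>\<omega>. (norm (?x t \<omega>))\<^sup>2)" for t
    using power2_expectation_nth_le[OF sq, of t i] by simp
  have "(\<lambda>t. ((((*v) A ^^ t) x) $ i)\<^sup>2) \<longlonglongrightarrow> 0"
    by (rule Lim_null_comparison[OF _ stable_const[of x]]) (simp add: le)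
  from tendsto_real_sqrt[OF this] have "(\<lambda>t. (((*v) A ^^ t) x) $ i) \<longlonglongrightarrow> 0"
    by (simp add: tendsto_rabs_zero_iff)
  then show "(\<lambda>t. (((*v) A ^^ t) x) $ i) \<longlonglongrightarrow> 0 $ i" by simp
qed

text \<open>\<open>K\<close> is fixed by the adjoint of the covariance map, so its pairing with an
  orbit of that map is constant in time and yet tends to zero. The orbit started at \<open>K\<close>
  itself gives \<open>K \<bullet> K = 0\<close>.\<close>

lemma covariance_op_fixpoint_eq_0:
  assumes "K = transpose A ** K ** A + transpose C ** K ** C"
  shows "K = 0"
proof -
  have "K \<bullet> X = K \<bullet> (covariance_op A C ^^ t) X" for X t
    by (induction t) (simp, simp add: inner_covariance_op flip: assms)
  moreover have "(\<lambda>t. K \<bullet> (covariance_op A C ^^ t) K) \<longlonglongrightarrow> K \<bullet> 0"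
    by (intro tendsto_inner tendsto_const covariance_op_power_tendsto_0)
  ultimately have "(\<lambda>t::nat. K \<bullet> K) \<longlonglongrightarrow> 0" by simp
  then show ?thesis by (simp add: LIMSEQ_const_iff)
qed

text \<open>The forcing is quadratic in the mean, and the mean is square summable; hence the forcing
  is absolutely summable and the unsquared recursion bound applies.\<close>

lemma covariance_tendsto_0:
  assumes x0: "x0 \<in> borel_measurable (F 0)" "sq_integrable M x0" and u: "u \<in> controls"
  defines "x \<equiv> state A b C \<xi> x0 u" and "y \<equiv> det_state A b (expectation x0) u"
  shows "(\<lambda>t. cross_moment M (\<lambda>\<omega>. x t \<omega> - y t) (\<lambda>\<omega>. x t \<omega> - y t)) \<longlonglongrightarrow> 0"
proof -
  define S where "S t = cross_moment M (\<lambda>\<omega>. x t \<omega> - y t) (\<lambda>\<omega>. x t \<omega> - y t)" for t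
  define w where "w t = outer (C *v y t) (C *v y t)" for t
  have rec: "S (Suc t) = covariance_op A C (S t) + w t" for t
    unfolding S_def w_def x_def y_def by (rule covariance_state(2)[OF x0])
  have y: "summable (\<lambda>t. (norm (y t))\<^sup>2)"
    unfolding y_def by (rule det_state_summable[OF matrix_power_tendsto_0 u])
  have w: "summable (\<lambda>t. norm (w t))"
  proof (rule summable_comparison_test')
    show "summable (\<lambda>t. (onorm ((*v) C))\<^sup>2 * (norm (y t))\<^sup>2)"
      using y by (rule summable_mult)
    show "norm (norm (w t)) \<le> (onorm ((*v) C))\<^sup>2 * (norm (y t))\<^sup>2" for t
      using power_mono[OF onorm[OF matrix_vector_mul_bounded_linear, of C "y t"], of 2]
      by (simp add: w_def norm_outer power2_eq_square mult_ac)
  qed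
  obtain K where K: "0 \<le> K" "\<forall>x w n. (\<forall>t. x (Suc t) = covariance_op A C (x t) + w t) \<longrightarrow>
      (\<Sum>t<n. norm (x t)) \<le> K * (norm (x 0) + (\<Sum>t<n. norm (w t)))"
    using stable_recursion_sum[OF linear_covariance_op covariance_op_power_tendsto_0] by blast
  have "summable (\<lambda>t. norm (S t))"
  proof (rule summableI_nonneg_bounded)
    fix n
    have "(\<Sum>t<n. norm (S t)) \<le> K * (norm (S 0) + (\<Sum>t<n. norm (w t)))"
      using K(2) rec by blast
    also have "\<dots> \<le> K * (norm (S 0) + (\<Sum>t. norm (w t)))"
      using K(1) w by (intro mult_left_mono add_left_mono sum_le_suminf) auto
    finally show "(\<Sum>t<n. norm (S t)) \<le> K * (norm (S 0) + (\<Sum>t. norm (w t)))" .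
  qed simp
  then show ?thesis
    unfolding S_def[symmetric] by (rule tendsto_norm_zero_cancel[OF summable_LIMSEQ_zero])
qed

text \<open>Pairing the covariance recursion with \<open>H\<close> gives \<open>G \<bullet> S t = H
  \<bullet> S t - H \<bullet> S (Suc t) + (\<Theta> - G) \<bullet> outer (y t) (y t)\<close>. The
  last term, caused by the noise acting on the mean, is what turns the weight \<open>G\<close> of
  the mean into \<Theta>.\<close>

lemma expected_cost_step:
  fixes H \<Theta> G :: "real ^ 'n ^ 'n" and u :: "nat \<Rightarrow> real ^ 'm"
  assumes x0: "x0 \<in> borel_measurable (F 0)" "sq_integrable M x0"
    and H: "transpose A ** H ** A - H + \<Theta> = 0" "\<Theta> - transpose C ** H ** C - G = 0"
  defines "x \<equiv> state A b C \<xi> x0 u" and "y \<equiv> det_state A b (expectation x0) u"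
  defines "S \<equiv> \<lambda>t. cross_moment M (\<lambda>\<omega>. x t \<omega> - y t) (\<lambda>\<omega>. x t \<omega> - y t)"
  shows "expectation (\<lambda>\<omega>. cost G \<gamma> \<Gamma> (x t \<omega>) (u t))
    = cost \<Theta> \<gamma> \<Gamma> (y t) (u t) + (H \<bullet> S t - H \<bullet> S (Suc t))"
proof -
  have sq: "sq_integrable M (x t)" and E: "expectation (x t) = y t"
    using state_adapted[OF x0] expectation_state[OF x0] by (simp_all add: x_def y_def)
  have P: "cross_moment M (x t) (x t) = S t + outer (y t) (y t)"
    and S: "S (Suc t) = covariance_op A C (S t) + outer (C *v y t) (C *v y t)"
    unfolding x_def y_def S_def by (rule covariance_state[OF x0])+
  have "expectation (\<lambda>\<omega>. cost G \<gamma> \<Gamma> (x t \<omega>) (u t)) = G \<bullet> S t + G \<bullet> outer (y t) (y t)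
      + 2 * (y t \<bullet> (\<gamma> *v u t)) + u t \<bullet> (\<Gamma> *v u t)"
    using expectation_quadratic_form[OF sq, of G] sq_integrable_integrable[OF sq]
    by (simp add: cost_def prob_space P inner_add_right E)
  moreover have "H \<bullet> S (Suc t) = (H - \<Theta>) \<bullet> S t + (\<Theta> - G) \<bullet> S t + (\<Theta> - G) \<bullet> outer (y t) (y t)"
  proof -
    have "transpose A ** H ** A = H - \<Theta>" "transpose C ** H ** C = \<Theta> - G"
      using H by (simp_all add: algebra_simps eq_diff_eq)
    moreover have "H \<bullet> outer (C *v y t) (C *v y t) = (transpose C ** H ** C) \<bullet> outer (y t) (y t)"
      by (simp add: outer_mult matrix_inner_congruence)
    ultimately show ?thesis
      by (simp add: S inner_add_right inner_covariance_op inner_add_left inner_diff_left)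
  qed
  ultimately show ?thesis
    by (simp add: inner_diff_left cost_def flip: inner_matrix_outer)
qed

lemma stoch_cost_eq:
  fixes H \<Theta> G :: "real ^ 'n ^ 'n"
  assumes x0: "x0 \<in> borel_measurable (F 0)" "sq_integrable M x0"
    and H: "transpose A ** H ** A - H + \<Theta> = 0" "\<Theta> - transpose C ** H ** C - G = 0"
    and u: "u \<in> controls"
  shows "stoch_cost M \<xi> x0 A b C G \<gamma> \<Gamma> u
    = (\<Sum>t. cost \<Theta> \<gamma> \<Gamma> (det_state A b (expectation x0) u t) (u t))
      + H \<bullet> cross_moment M (\<lambda>\<omega>. x0 \<omega> - expectation x0) (\<lambda>\<omega>. x0 \<omega> - expectation x0)"
proof -
  let ?y = "det_state A b (expectation x0) u"
  let ?x = "state A b C \<xi> x0 u"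
  define h where "h t = H \<bullet> cross_moment M (\<lambda>\<omega>. ?x t \<omega> - ?y t) (\<lambda>\<omega>. ?x t \<omega> - ?y t)" for t
  have "h \<longlonglongrightarrow> H \<bullet> 0"
    unfolding h_def by (intro tendsto_inner tendsto_const covariance_tendsto_0 x0 u)
  then have "(\<lambda>t. h t - h (Suc t)) sums h 0"
    using telescope_sums'[of h 0] by simp
  moreover have "summable (\<lambda>t. cost \<Theta> \<gamma> \<Gamma> (?y t) (u t))"
    using u by (intro summable_cost det_state_summable matrix_power_tendsto_0) (auto simp: controls_def)
  ultimately have "(\<lambda>t. cost \<Theta> \<gamma> \<Gamma> (?y t) (u t) + (h t - h (Suc t)))
      sums ((\<Sum>t. cost \<Theta> \<gamma> \<Gamma> (?y t) (u t)) + h 0)"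
    by (intro sums_add summable_sums)
  also have "(\<lambda>t. cost \<Theta> \<gamma> \<Gamma> (?y t) (u t) + (h t - h (Suc t)))
      = (\<lambda>t. expectation (\<lambda>\<omega>. cost G \<gamma> \<Gamma> (?x t \<omega>) (u t)))"
    unfolding h_def by (simp only: expected_cost_step[OF x0 H])
  finally show ?thesis
    by (simp add: stoch_cost_def Let_def cost_def sums_iff h_def)
qed

end

end

section \<open>Discrete Fourier transform and the frequency condition\<close>

definition unity_root :: "nat \<Rightarrow> nat \<Rightarrow> complex" where
  "unity_root N k = cis (2 * pi * real k / real N)"

lemma norm_unity_root: "cmod (unity_root N k) = 1"
  by (simp add: unity_root_def)

lemma cnj_unity_root_mult: "cnj (unity_root N k) * unity_root N k = 1"
  using complex_norm_square[of "unity_root N k"] by (simp add: norm_unity_root mult.commute)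

text \<open>Index and exponent may be exchanged, since both sides have argument
  \<open>2 * pi * k * t / N\<close>.\<close>

lemma unity_root_power: "unity_root N k ^ t = unity_root N t ^ k"
  by (simp add: unity_root_def Complex.DeMoivre mult_ac)

lemma unity_root_power_N:
  assumes "N > 0"
  shows "unity_root N k ^ N = 1"
  using assms cis_multiple_2pi[of "real k"] by (simp add: unity_root_def Complex.DeMoivre)

text \<open>Exchanging index and exponent makes this a geometric sum over \<open>k\<close> whose
  ratio \<open>c\<close> satisfies \<open>c ^ N = 1\<close> and, for distinct \<open>s\<close> and
  \<open>t\<close>, differs from 1.\<close>

lemma roots_unity_orthogonal:
  assumes "N > 0" "s < N" "t < N"
  shows "(\<Sum>k<N. cnj (unity_root N k) ^ s * unity_root N k ^ t) = (if s = t then of_nat N else 0)"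
proof -
  define c where "c = cnj (unity_root N s) * unity_root N t"
  have cnj_power: "cnj (unity_root N k) ^ s = cnj (unity_root N s) ^ k" for k s
    by (metis complex_cnj_power unity_root_power)
  have "(\<Sum>k<N. cnj (unity_root N k) ^ s * unity_root N k ^ t) = (\<Sum>k<N. c ^ k)"
    by (simp only: c_def power_mult_distrib unity_root_power[of N _ t] cnj_power[of _ s])
  also have "\<dots> = (if s = t then of_nat N else 0)"
  proof (cases "s = t")
    case True
    then show ?thesis by (simp add: c_def cnj_unity_root_mult)
  next
    case False
    have "c \<noteq> 1"
    proof
      assume "c = 1"
      then have "unity_root N s = (cnj (unity_root N s) * unity_root N s) * unity_root N t"
        by (simp add: c_def mult_ac)
      then have "unity_root N s = unity_root N t" by (simp add: cnj_unity_root_mult)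
      moreover have "inj_on (unity_root N) {..<N}"
        using Complex.bij_betw_roots_unity[OF assms(1)] by (simp add: bij_betw_def unity_root_def[abs_def])
      ultimately show False using False assms by (auto dest: inj_onD)
    qed
    moreover have "c ^ N = 1"
      by (simp add: c_def power_mult_distrib unity_root_power_N[OF assms(1)] flip: complex_cnj_power)
    ultimately show ?thesis using False by (simp add: geometric_sum)
  qed
  finally show ?thesis .
qed

definition dft :: "nat \<Rightarrow> (nat \<Rightarrow> complex ^ 'n) \<Rightarrow> nat \<Rightarrow> complex ^ 'n" where
  "dft N x k = (\<Sum>t<N. cnj (unity_root N k) ^ t *s x t)"

lemma dft_nth: "dft N x k $ i = (\<Sum>t<N. cnj (unity_root N k) ^ t * x t $ i)"
  by (simp add: dft_def)

lemma dft_matrix_mult: "dft N (\<lambda>t. A *v x t) k = A *v dft N x k"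
  by (simp add: vec_eq_iff dft_nth matrix_vector_mult_def sum_distrib_left)
     (subst sum.swap, simp add: mult_ac)

lemma dft_add: "dft N (\<lambda>t. x t + y t) k = dft N x k + dft N y k"
  by (simp add: vec_eq_iff dft_nth sum.distrib distrib_left)

text \<open>Periodicity lets the last term of the shifted sum replace the missing first one. A
  linear recursion thereby becomes an algebraic equation at each frequency.\<close>

lemma dft_shift:
  assumes "N > 0" "x N = x 0"
  shows "dft N (\<lambda>t. x (Suc t)) k = unity_root N k *s dft N x k"
proof -
  define e where "e = unity_root N k"
  have ee: "e * cnj e = 1" using cnj_unity_root_mult by (simp add: e_def mult.commute)
  have eN: "cnj e ^ N = 1"
    by (simp add: e_def unity_root_power_N[OF assms(1)] flip: complex_cnj_power)
  have "(\<Sum>t<N. cnj e ^ t * x (Suc t) $ i) = e * (\<Sum>t<N. cnj e ^ t * x t $ i)" for i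
  proof -
    have "(\<Sum>t<N. cnj e ^ t * x (Suc t) $ i) = (\<Sum>t<N. (e * cnj e) * (cnj e ^ t * x (Suc t) $ i))"
      by (simp add: ee)
    also have "\<dots> = e * (\<Sum>t<N. cnj e ^ Suc t * x (Suc t) $ i)"
      by (simp add: sum_distrib_left mult_ac)
    also have "(\<Sum>t<N. cnj e ^ Suc t * x (Suc t) $ i) = (\<Sum>t<N. cnj e ^ t * x t $ i)"
      using sum.lessThan_Suc_shift[of "\<lambda>t. cnj e ^ t * x t $ i" N]
        sum.lessThan_Suc[of "\<lambda>t. cnj e ^ t * x t $ i" N] assms(2) eN by simp
    finally show ?thesis .
  qed
  then show ?thesis by (simp add: vec_eq_iff dft_nth e_def)
qed

text \<open>Parseval identity in polarized form; the factor \<open>N\<close> appears because the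
  transform is not normalized.\<close>

lemma star_prod_dft:
  assumes "N > 0"
  shows "(\<Sum>k<N. star_prod (dft N x k) (dft N y k)) = of_nat N * (\<Sum>t<N. star_prod (x t) (y t))"
proof -
  have one: "(\<Sum>k<N. cnj (dft N x k $ i) * dft N y k $ i) = of_nat N * (\<Sum>t<N. cnj (x t $ i) * y t $ i)" for i
  proof -
    have "(\<Sum>k<N. cnj (dft N x k $ i) * dft N y k $ i)
        = (\<Sum>k<N. \<Sum>s<N. \<Sum>t<N. (cnj (unity_root N k) ^ t * unity_root N k ^ s) * (cnj (x s $ i) * y t $ i))"
    proof -
      have "cnj (dft N x k $ i) * dft N y k $ i
          = (\<Sum>s<N. \<Sum>t<N. (unity_root N k ^ s * cnj (x s $ i)) * (cnj (unity_root N k) ^ t * y t $ i))" for k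
        by (simp add: dft_nth sum_product)
      then show ?thesis by (simp add: mult_ac)
    qed
    also have "\<dots> = (\<Sum>s<N. \<Sum>k<N. \<Sum>t<N. (cnj (unity_root N k) ^ t * unity_root N k ^ s) * (cnj (x s $ i) * y t $ i))"
      by (rule sum.swap)
    also have "\<dots> = (\<Sum>s<N. \<Sum>t<N. \<Sum>k<N. (cnj (unity_root N k) ^ t * unity_root N k ^ s) * (cnj (x s $ i) * y t $ i))"
      by (intro sum.cong refl sum.swap)
    also have "\<dots> = (\<Sum>s<N. \<Sum>t<N. (if t = s then of_nat N else 0) * (cnj (x s $ i) * y t $ i))"
      unfolding sum_distrib_right[symmetric]
      by (intro sum.cong refl arg_cong2[where f = "(*)"] roots_unity_orthogonal assms) auto
    also have "\<dots> = (\<Sum>s<N. of_nat N * (cnj (x s $ i) * y s $ i))"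
    proof (intro sum.cong refl)
      fix s assume "s \<in> {..<N}"
      moreover have "(\<Sum>t<N. (if t = s then of_nat N else 0) * (cnj (x s $ i) * y t $ i))
          = (\<Sum>t<N. if t = s then of_nat N * (cnj (x s $ i) * y t $ i) else 0)"
        by (intro sum.cong) auto
      ultimately show "(\<Sum>t<N. (if t = s then of_nat N else 0) * (cnj (x s $ i) * y t $ i))
          = of_nat N * (cnj (x s $ i) * y s $ i)" by (simp add: sum.delta)
    qed
    finally show ?thesis by (simp add: sum_distrib_left)
  qed
  have "(\<Sum>k<N. star_prod (dft N x k) (dft N y k))
      = (\<Sum>i\<in>UNIV. \<Sum>k<N. cnj (dft N x k $ i) * dft N y k $ i)"
    unfolding star_prod_def by (rule sum.swap)
  also have "\<dots> = of_nat N * (\<Sum>i\<in>UNIV. \<Sum>t<N. cnj (x t $ i) * y t $ i)"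
    by (simp only: one sum_distrib_left)
  also have "(\<Sum>i\<in>UNIV. \<Sum>t<N. cnj (x t $ i) * y t $ i) = (\<Sum>t<N. star_prod (x t) (y t))"
    unfolding star_prod_def by (rule sum.swap)
  finally show ?thesis .
qed

lemma cost_form_dft:
  assumes "N > 0"
  shows "(\<Sum>k<N. cost_form Q \<gamma> \<Gamma> (dft N x k) (dft N u k)) = of_nat N * (\<Sum>t<N. cost_form Q \<gamma> \<Gamma> (x t) (u t))"
proof -
  \<comment> \<open>The real part is not complex linear, so the mixed term is treated in the reals
    and embedded again afterwards.\<close>
  have "(\<Sum>k<N. Re (star_prod (dft N x k) (\<gamma> *v dft N u k))) = real N * (\<Sum>t<N. Re (star_prod (x t) (\<gamma> *v u t)))"
    using arg_cong[OF star_prod_dft[OF assms, of x "\<lambda>t. \<gamma> *v u t"], of Re]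
    by (simp add: dft_matrix_mult)
  from arg_cong[OF this, of "\<lambda>r. complex_of_real (2 * r)"]
  have "(\<Sum>k<N. complex_of_real (2 * Re (star_prod (dft N x k) (\<gamma> *v dft N u k))))
      = of_nat N * (\<Sum>t<N. complex_of_real (2 * Re (star_prod (x t) (\<gamma> *v u t))))"
    by (simp add: sum_distrib_left mult.left_commute)
  then show ?thesis
    using star_prod_dft[OF assms, of x "\<lambda>t. Q *v x t"] star_prod_dft[OF assms, of u "\<lambda>t. \<Gamma> *v u t"]
    by (simp add: cost_form_def sum.distrib dft_matrix_mult distrib_left)
qed

section \<open>Real data inside complex forms\<close>

lemma star_prod_self: "star_prod u u = complex_of_real ((norm u)\<^sup>2)"
proof -
  have "cnj z * z = complex_of_real ((cmod z)\<^sup>2)" for z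
    by (metis complex_norm_square mult.commute)
  then show ?thesis by (simp add: star_prod_def norm_vec_def L2_set_def sum_nonneg)
qed

lemma cmat_mult_cvec: "cmat A *v cvec x = cvec (A *v x)"
  by (simp add: vec_eq_iff cvec_def matrix_vector_mult_def)

lemma star_prod_cvec: "star_prod (cvec x) (cvec y) = complex_of_real (x \<bullet> y)"
  by (simp add: star_prod_def cvec_def inner_vec_def)

lemma cvec_add: "cvec (x + y) = cvec x + cvec y"
  by (simp add: vec_eq_iff cvec_def)

lemma norm_cvec: "norm (cvec x) = norm x"
  by (simp add: norm_vec_def cvec_def)

lemma cost_form_cvec:
  "cost_form (cmat Q) (cmat \<gamma>) (cmat \<Gamma>) (cvec x) (cvec u) = complex_of_real (cost Q \<gamma> \<Gamma> x u)"
  by (simp add: cost_form_def cost_def cmat_mult_cvec star_prod_cvec)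

text \<open>If \<open>A v = z v\<close> with \<open>\<bar>z\<bar> = 1\<close>, the real and imaginary parts of \<open>v\<close> give real orbits of \<open>A\<close>
  one of which does not tend to \<open>0\<close>.\<close>

lemma Re_complex_of_real_mult: "Re (complex_of_real r * z) = r * Re z"
  and Im_complex_of_real_mult: "Im (complex_of_real r * z) = r * Im z"
  by simp_all

lemma stable_no_unit_eigenvalue:
  fixes A :: "real ^ 'n ^ 'n"
  assumes A: "\<And>x. (\<lambda>t. ((*v) A ^^ t) x) \<longlonglongrightarrow> 0" and z: "cmod z = 1"
    and v: "(mat z - cmat A) *v v = 0"
  shows "v = 0"
proof -
  have "mat z *v v = z *s v"
    by (simp add: vec_eq_iff matrix_vector_mult_def mat_def if_distrib[of "\<lambda>x. x * _"] cong: if_cong)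
  with v have eig: "cmat A *v v = z *s v"
    by (simp add: matrix_vector_mult_diff_rdistrib)
  have step: "(\<Sum>j\<in>UNIV. complex_of_real (A $ i $ j) * (z ^ t * v $ j)) = z ^ Suc t * v $ i" for i t
  proof -
    have "(\<Sum>j\<in>UNIV. complex_of_real (A $ i $ j) * (z ^ t * v $ j)) = z ^ t * (cmat A *v v) $ i"
      by (simp add: matrix_vector_mult_def sum_distrib_left mult_ac)
    then show ?thesis by (simp add: eig)
  qed
  have re: "((*v) A ^^ t) (\<chi> i. Re (v $ i)) = (\<chi> i. Re (z ^ t * v $ i))" for t
  proof (induction t)
    case (Suc t)
    have "A *v (\<chi> i. Re (z ^ t * v $ i)) = (\<chi> i. Re (z ^ Suc t * v $ i))"
      unfolding vec_eq_iff step[symmetric]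
      by (simp only: matrix_vector_mult_def vec_lambda_beta Re_sum Re_complex_of_real_mult, simp)
    then show ?case by (simp only: funpow.simps comp_apply Suc)
  qed simp
  have im: "((*v) A ^^ t) (\<chi> i. Im (v $ i)) = (\<chi> i. Im (z ^ t * v $ i))" for t
  proof (induction t)
    case (Suc t)
    have "A *v (\<chi> i. Im (z ^ t * v $ i)) = (\<chi> i. Im (z ^ Suc t * v $ i))"
      unfolding vec_eq_iff step[symmetric]
      by (simp only: matrix_vector_mult_def vec_lambda_beta Im_sum Im_complex_of_real_mult, simp)
    then show ?case by (simp only: funpow.simps comp_apply Suc)
  qed simp
  have "v $ i = 0" for i
  proof -
    \<comment> \<open>As \<open>z\<close> has modulus 1, the left side equals
      \<open>cmod (z ^ t * v $ i)\<close> for every \<open>t\<close>, while both orbits on the right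
      vanish in the limit.\<close>
    have "cmod (v $ i) \<le> \<bar>((*v) A ^^ t) (\<chi> i. Re (v $ i)) $ i\<bar> + \<bar>((*v) A ^^ t) (\<chi> i. Im (v $ i)) $ i\<bar>" for t
      using cmod_le[of "z ^ t * v $ i"] z by (simp add: re im norm_mult norm_power)
    moreover have "(\<lambda>t. \<bar>((*v) A ^^ t) (\<chi> i. Re (v $ i)) $ i\<bar> + \<bar>((*v) A ^^ t) (\<chi> i. Im (v $ i)) $ i\<bar>)
        \<longlonglongrightarrow> \<bar>(0 :: real ^ 'n) $ i\<bar> + \<bar>(0 :: real ^ 'n) $ i\<bar>"
      by (intro tendsto_intros A)
    ultimately have "cmod (v $ i) \<le> \<bar>(0 :: real ^ 'n) $ i\<bar> + \<bar>(0 :: real ^ 'n) $ i\<bar>"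
      by (intro LIMSEQ_le_const) auto
    then show ?thesis by simp
  qed
  then show ?thesis by (simp add: vec_eq_iff)
qed

text \<open>\<open>matrix_inv\<close> is a choice of a two-sided inverse, which is meaningful only
  once one exists; for a square matrix a trivial kernel provides it.\<close>

lemma matrix_inv_mult_eq:
  fixes B :: "'a::field ^ 'n ^ 'n"
  assumes "\<And>v. B *v v = 0 \<Longrightarrow> v = 0" "B *v x = y"
  shows "matrix_inv B *v y = x"
proof -
  have "\<forall>v. B *v v = 0 \<longrightarrow> v = 0" using assms(1) by simp
  then obtain D where D: "D ** B = mat 1" unfolding matrix_left_invertible_ker[symmetric] ..
  then have "B ** D = mat 1 \<and> D ** B = mat 1" by (simp add: matrix_left_right_inverse[of B D])
  then have "B ** matrix_inv B = mat 1 \<and> matrix_inv B ** B = mat 1" unfolding matrix_inv_def by (rule someI)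
  then have "matrix_inv B *v (B *v x) = x" by (simp add: matrix_vector_mul_assoc)
  then show ?thesis by (simp add: assms(2))
qed

definition frequency_bound ::
  "real ^ 'n ^ 'n \<Rightarrow> real ^ 'm ^ 'n \<Rightarrow> complex ^ 'n ^ 'n \<Rightarrow> real ^ 'm ^ 'n \<Rightarrow> real ^ 'm ^ 'm \<Rightarrow> real \<Rightarrow> bool" where
  "frequency_bound A b \<Theta> \<gamma> \<Gamma> \<delta> \<longleftrightarrow> (\<forall>z. cmod z = 1 \<longrightarrow> (\<forall>u.
     cost_form \<Theta> (cmat \<gamma>) (cmat \<Gamma>) (matrix_inv (mat z - cmat A) *v (cmat b *v u)) u
       \<ge> complex_of_real (\<delta> * (norm u)\<^sup>2)))"

text \<open>Transforming the recursion gives \<open>z *s X = A X + b U\<close> at each root of unity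
  \<open>z\<close>, so the coefficient \<open>X\<close> is the resolvent applied to
  \<open>b U\<close> and the frequency condition holds coefficient by coefficient. Only the state
  has to return to its start; the control enters through its first \<open>N\<close> values
  alone.\<close>

lemma periodic_cost_bound:
  fixes A :: "real ^ 'n ^ 'n" and b :: "real ^ 'm ^ 'n"
  assumes A: "\<And>x. (\<lambda>t. ((*v) A ^^ t) x) \<longlonglongrightarrow> 0" and freq: "frequency_bound A b (cmat Q) \<gamma> \<Gamma> \<delta>"
    and x: "\<And>t. x (Suc t) = A *v x t + b *v u t" "x N = x 0" and N: "N > 0"
  shows "\<delta> * (\<Sum>t<N. (norm (u t))\<^sup>2) \<le> (\<Sum>t<N. cost Q \<gamma> \<Gamma> (x t) (u t))"
proof -
  let ?X = "dft N (\<lambda>t. cvec (x t))" and ?U = "dft N (\<lambda>t. cvec (u t))"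
  have "complex_of_real (\<delta> * (norm (?U k))\<^sup>2) \<le> cost_form (cmat Q) (cmat \<gamma>) (cmat \<Gamma>) (?X k) (?U k)" for k
  proof -
    define z where "z = unity_root N k"
    have z: "cmod z = 1" by (simp add: z_def norm_unity_root)
    have "z *s ?X k = dft N (\<lambda>t. cvec (x (Suc t))) k"
      unfolding z_def using x(2) by (intro dft_shift[symmetric] N) simp
    also have "\<dots> = cmat A *v ?X k + cmat b *v ?U k"
      by (simp add: x(1) cvec_add cmat_mult_cvec dft_add flip: dft_matrix_mult)
    finally have "z *s ?X k - cmat A *v ?X k = cmat b *v ?U k" by simp
    moreover have "mat z *v ?X k = z *s ?X k"
      by (simp add: vec_eq_iff matrix_vector_mult_def mat_def if_distrib[of "\<lambda>x. x * _"] cong: if_cong)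
    ultimately have "(mat z - cmat A) *v ?X k = cmat b *v ?U k"
      by (simp add: matrix_vector_mult_diff_rdistrib)
    from stable_no_unit_eigenvalue[OF A z] this
    have "matrix_inv (mat z - cmat A) *v (cmat b *v ?U k) = ?X k"
      by (rule matrix_inv_mult_eq)
    with freq z show ?thesis unfolding frequency_bound_def by metis
  qed
  then have "Re (\<Sum>k<N. complex_of_real (\<delta> * (norm (?U k))\<^sup>2))
      \<le> Re (\<Sum>k<N. cost_form (cmat Q) (cmat \<gamma>) (cmat \<Gamma>) (?X k) (?U k))"
    unfolding Re_sum by (intro sum_mono) (simp add: less_eq_complex_def)
  then have "\<delta> * (\<Sum>k<N. (norm (?U k))\<^sup>2) \<le> real N * (\<Sum>t<N. cost Q \<gamma> \<Gamma> (x t) (u t))"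
    by (simp add: cost_form_dft[OF N] cost_form_cvec sum_distrib_left)
  moreover have "(\<Sum>k<N. (norm (?U k))\<^sup>2) = real N * (\<Sum>t<N. (norm (u t))\<^sup>2)"
  proof -
    have "complex_of_real (\<Sum>k<N. (norm (?U k))\<^sup>2) = complex_of_real (real N * (\<Sum>t<N. (norm (u t))\<^sup>2))"
      using star_prod_dft[OF N, of "\<lambda>t. cvec (u t)" "\<lambda>t. cvec (u t)"]
      by (simp add: star_prod_self norm_cvec)
    then show ?thesis by (simp only: of_real_eq_iff)
  qed
  ultimately have "real N * (\<delta> * (\<Sum>t<N. (norm (u t))\<^sup>2)) \<le> real N * (\<Sum>t<N. cost Q \<gamma> \<Gamma> (x t) (u t))"
    by (simp add: mult.left_commute)
  then show ?thesis using N by simp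
qed

section \<open>Minimization of coercive quadratic functionals\<close>

lemma Cauchy_Schwarz_summable:
  fixes p q :: "nat \<Rightarrow> 'a::real_normed_vector"
  assumes p: "summable (\<lambda>t. (norm (p t))\<^sup>2)" and q: "summable (\<lambda>t. (norm (q t))\<^sup>2)"
  shows "(\<Sum>t<n. norm (p t) * norm (q t)) \<le> sqrt (\<Sum>t. (norm (p t))\<^sup>2) * sqrt (\<Sum>t. (norm (q t))\<^sup>2)"
proof -
  have "(\<Sum>t<n. norm (p t) * norm (q t)) \<le> L2_set (\<lambda>t. norm (p t)) {..<n} * L2_set (\<lambda>t. norm (q t)) {..<n}"
    using L2_set_mult_ineq[of "\<lambda>t. norm (p t)" "\<lambda>t. norm (q t)" "{..<n}"] by simp
  also have "\<dots> \<le> sqrt (\<Sum>t. (norm (p t))\<^sup>2) * sqrt (\<Sum>t. (norm (q t))\<^sup>2)"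
    unfolding L2_set_def
    by (intro mult_mono real_sqrt_le_mono sum_le_suminf p q) (auto intro: suminf_nonneg p sum_nonneg)
  finally show ?thesis .
qed

lemma controls_scaled_add:
  assumes "u \<in> controls" "v \<in> controls"
  shows "(\<lambda>t. c *\<^sub>R u t + d *\<^sub>R v t) \<in> controls"
proof -
  have "summable (\<lambda>t. 2 * c\<^sup>2 * (norm (u t))\<^sup>2 + 2 * d\<^sup>2 * (norm (v t))\<^sup>2)"
    using assms by (intro summable_add summable_mult) (auto simp: controls_def)
  moreover have "norm ((norm (c *\<^sub>R u t + d *\<^sub>R v t))\<^sup>2) \<le> 2 * c\<^sup>2 * (norm (u t))\<^sup>2 + 2 * d\<^sup>2 * (norm (v t))\<^sup>2" for t
    using power_mono[OF norm_triangle_ineq, of "c *\<^sub>R u t" "d *\<^sub>R v t" 2]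
      sum_squares_bound[of "norm (c *\<^sub>R u t)" "norm (d *\<^sub>R v t)"]
    by (simp add: power2_sum power_mult_distrib)
  ultimately show ?thesis
    unfolding controls_def by (auto intro: summable_comparison_test')
qed

lemma
  assumes "u \<in> controls" "v \<in> controls"
  shows controls_add: "(\<lambda>t. u t + v t) \<in> controls"
    and controls_diff: "(\<lambda>t. u t - v t) \<in> controls"
    and controls_midpoint: "(\<lambda>t. (1/2) *\<^sub>R (u t + v t)) \<in> controls"
  using controls_scaled_add[OF assms, of 1 1] controls_scaled_add[OF assms, of 1 "-1"]
    controls_scaled_add[OF assms, of "1/2" "1/2"]
  by (simp_all add: scaleR_right_distrib)

lemma zero_controls: "(\<lambda>_. 0) \<in> controls"
  by (simp add: controls_def)

text \<open>\<open>J\<close> is a quadratic functional with linear and constant terms, and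
  \<open>J\<^sub>0\<close> is its homogeneous quadratic part. The parallelogram identity with
  coercivity is strong convexity; the last assumption says that the first-order part at each point
  is bounded in the norm of square-summable sequences.\<close>

locale coercive_quadratic =
  fixes J J\<^sub>0 :: "(nat \<Rightarrow> real ^ 'm) \<Rightarrow> real" and \<delta> :: real
  assumes \<delta>: "\<delta> > 0"
    and coercive: "\<And>w. w \<in> controls \<Longrightarrow> \<delta> * (\<Sum>t. (norm (w t))\<^sup>2) \<le> J\<^sub>0 w"
    and parallelogram: "\<And>u v. u \<in> controls \<Longrightarrow> v \<in> controls \<Longrightarrow>
      J (\<lambda>t. (1/2) *\<^sub>R (u t + v t)) = (J u + J v) / 2 - J\<^sub>0 (\<lambda>t. u t - v t) / 4"
    and linear_part: "\<And>u. u \<in> controls \<Longrightarrow> \<exists>K. \<forall>w\<in>controls.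
      \<bar>J (\<lambda>t. u t + w t) - J u - J\<^sub>0 w\<bar> \<le> K * sqrt (\<Sum>t. (norm (w t))\<^sup>2)"
begin

lemma bdd_below_J: "bdd_below (J ` controls)"
proof -
  obtain K where K: "\<bar>J (\<lambda>t. 0 + w t) - J (\<lambda>_. 0) - J\<^sub>0 w\<bar> \<le> K * sqrt (\<Sum>t. (norm (w t))\<^sup>2)"
    if "w \<in> controls" for w
    using linear_part[OF zero_controls] by blast
  \<comment> \<open>The constant \<open>K\<^sup>2 / (4 * \<delta>)\<close> comes from completing the
    square in \<open>\<delta> * s\<^sup>2 - K * s\<close>.\<close>
  have "J (\<lambda>_. 0) - K\<^sup>2 / (4 * \<delta>) \<le> J w" if w: "w \<in> controls" for w
  proof -
    define s where "s = sqrt (\<Sum>t. (norm (w t))\<^sup>2)"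
    have s2: "(\<Sum>t. (norm (w t))\<^sup>2) = s\<^sup>2"
      using w by (simp add: s_def suminf_nonneg controls_def)
    have "J (\<lambda>_. 0) + \<delta> * s\<^sup>2 - K * s \<le> J w"
      using K[OF w, folded s_def] coercive[OF w, unfolded s2] by (simp add: abs_le_iff)
    moreover have "\<delta> * s\<^sup>2 - K * s + K\<^sup>2 / (4 * \<delta>) = \<delta> * (s - K / (2 * \<delta>))\<^sup>2"
      using \<delta> by (simp add: field_simps power2_eq_square)
    moreover have "0 \<le> \<delta> * (s - K / (2 * \<delta>))\<^sup>2" using \<delta> by simp
    ultimately show ?thesis by linarith
  qed
  then show ?thesis by (rule bdd_belowI2)
qed

text \<open>The midpoint cannot fall below the infimum, so the parallelogram identity leaves at most
  \<open>4 * e\<close> for the quadratic part of the difference.\<close>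

lemma near_minimal_close:
  assumes u: "u \<in> controls" and v: "v \<in> controls"
    and e: "J u \<le> Inf (J ` controls) + e" "J v \<le> Inf (J ` controls) + e"
  shows "(\<Sum>t. (norm (u t - v t))\<^sup>2) \<le> 4 * e / \<delta>"
proof -
  have "Inf (J ` controls) \<le> J (\<lambda>t. (1/2) *\<^sub>R (u t + v t))"
    by (intro cInf_lower bdd_below_J imageI controls_midpoint u v)
  from this[unfolded parallelogram[OF u v]] have "J\<^sub>0 (\<lambda>t. u t - v t) \<le> 4 * e"
    using e by (simp add: field_simps)
  with coercive[OF controls_diff[OF u v]] \<delta> show ?thesis by (simp add: field_simps)
qed

lemma optimal_control_equiv:
  assumes u: "optimal_control J u" and v: "optimal_control J v"
  shows "control_equiv u v"
proof -
  have C: "u \<in> controls" "v \<in> controls" using u v by (auto simp: optimal_control_def)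
  have "J u \<le> Inf (J ` controls) + 0" "J v \<le> Inf (J ` controls) + 0"
    using u v by (auto intro!: cInf_greatest simp: optimal_control_def)
  from near_minimal_close[OF C this] have le: "(\<Sum>t. (norm (u t - v t))\<^sup>2) \<le> 0" by simp
  have sm: "summable (\<lambda>t. (norm (u t - v t))\<^sup>2)"
    using controls_diff[OF C] by (simp add: controls_def)
  have "(\<Sum>t. (norm (u t - v t))\<^sup>2) = 0"
    using le suminf_nonneg[OF sm] by simp
  with sm show ?thesis by (simp add: control_equiv_def sums_iff)
qed

text \<open>A minimizing sequence is Cauchy in the square-sum norm by strong convexity. Its limit is
  built coordinate by coordinate and then recognized as a limit in norm.\<close>

lemma optimal_control_exists: "\<exists>u. optimal_control J u"
proof -
  define m where "m = Inf (J ` controls)"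
  define e where "e k = 1 / real (Suc k)" for k
  have e: "e k > 0" "k \<le> l \<Longrightarrow> e l \<le> e k" for k l
    by (simp_all add: e_def field_simps)
  have e0: "e \<longlonglongrightarrow> 0"
    unfolding e_def using LIMSEQ_inverse_real_of_nat by (simp add: inverse_eq_divide)
  have "\<exists>u\<in>controls. J u < m + e k" for k
  proof -
    have "J ` controls \<noteq> {}" using zero_controls by blast
    moreover have "Inf (J ` controls) < m + e k" using e by (simp add: m_def)
    ultimately show ?thesis using cInf_lessD[of "J ` controls" "m + e k"] by auto
  qed
  then obtain U where U: "U k \<in> controls" "J (U k) < m + e k" for k by metis
  have close: "(\<Sum>t. (norm (U k t - U l t))\<^sup>2) \<le> 4 * e k / \<delta>" if "k \<le> l" for k l
    using U(2)[of k] U(2)[of l] e(2)[OF that]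
    by (intro near_minimal_close U) (auto simp: m_def[symmetric])
  have sm: "summable (\<lambda>t. (norm (U k t - U l t))\<^sup>2)" for k l
    using controls_diff[OF U(1) U(1)] by (simp add: controls_def)
  have "Cauchy (\<lambda>k. U k t)" for t
  proof (rule CauchyI')
    fix r :: real assume r: "r > 0"
    have "(\<lambda>k. 4 * e k / \<delta>) \<longlonglongrightarrow> 4 * 0 / \<delta>" by (intro tendsto_intros e0) (use \<delta> in simp)
    then have "\<forall>\<^sub>F k in sequentially. 4 * e k / \<delta> < r\<^sup>2"
      using r by (intro order_tendstoD) auto
    then obtain N where N: "\<And>k. k \<ge> N \<Longrightarrow> 4 * e k / \<delta> < r\<^sup>2"
      by (auto simp: eventually_sequentially)
    have "dist (U k t) (U l t) < r" if "k \<ge> N" "l > k" for k l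
    proof -
      have "(norm (U k t - U l t))\<^sup>2 \<le> (\<Sum>t. (norm (U k t - U l t))\<^sup>2)"
        using sum_le_suminf[OF sm, of "{t}" k l] by simp
      also have "\<dots> < r\<^sup>2" using close[of k l] N[of k] that by simp
      finally show ?thesis using r by (simp add: dist_norm power2_less_imp_less)
    qed
    then show "\<exists>N. \<forall>k\<ge>N. \<forall>l>k. dist (U k t) (U l t) < r" by blast
  qed
  then have "\<exists>x. (\<lambda>k. U k t) \<longlonglongrightarrow> x" for t
    by (simp add: Cauchy_convergent_iff convergent_def)
  then obtain u where u: "(\<lambda>k. U k t) \<longlonglongrightarrow> u t" for t by metis
  \<comment> \<open>Finite sums are continuous in the coordinates, so the distance estimate survives
    the limit in \<open>l\<close>; the bound free of \<open>T\<close> then gives summability of the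
    whole series.\<close>
  have partial: "(\<Sum>t<T. (norm (U k t - u t))\<^sup>2) \<le> 4 * e k / \<delta>" for T k
  proof (rule LIMSEQ_le_const2)
    show "(\<lambda>l. \<Sum>t<T. (norm (U k t - U l t))\<^sup>2) \<longlonglongrightarrow> (\<Sum>t<T. (norm (U k t - u t))\<^sup>2)"
      by (intro tendsto_intros u)
    have "(\<Sum>t<T. (norm (U k t - U l t))\<^sup>2) \<le> 4 * e k / \<delta>" if "k \<le> l" for l
      using sum_le_suminf[OF sm, of "{..<T}" k l] close[OF that] by simp
    then show "\<exists>N. \<forall>l\<ge>N. (\<Sum>t<T. (norm (U k t - U l t))\<^sup>2) \<le> 4 * e k / \<delta>" by blast
  qed
  define w where "w k t = U k t - u t" for k t
  have w: "w k \<in> controls" and n2: "(\<Sum>t. (norm (w k t))\<^sup>2) \<le> 4 * e k / \<delta>" for k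
  proof -
    have "summable (\<lambda>t. (norm (w k t))\<^sup>2)"
      using partial[of k] by (intro summableI_nonneg_bounded) (auto simp: w_def)
    then show "w k \<in> controls" "(\<Sum>t. (norm (w k t))\<^sup>2) \<le> 4 * e k / \<delta>"
      using partial[of k] by (auto simp: controls_def w_def intro: suminf_le_const)
  qed
  have "u \<in> controls"
    using controls_diff[OF U(1) w, of 0 0] by (simp add: w_def)
  obtain K where K: "\<bar>J (\<lambda>t. u t + w t) - J u - J\<^sub>0 w\<bar> \<le> K * sqrt (\<Sum>t. (norm (w t))\<^sup>2)"
    if "w \<in> controls" for w
    using linear_part[OF \<open>u \<in> controls\<close>] by blast
  \<comment> \<open>Expanding \<open>J (U k)\<close> around \<open>u\<close>, the quadratic part is
    nonnegative and may be dropped. The absolute value is taken because the sign of \<open>K\<close>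
    is not known.\<close>
  have "J u \<le> m + e k + \<bar>K\<bar> * sqrt (4 * e k / \<delta>)" for k
  proof -
    have "0 \<le> J\<^sub>0 (w k)"
      using \<delta> w[of k]
      by (intro order_trans[OF _ coercive[OF w[of k]]] mult_nonneg_nonneg suminf_nonneg) (auto simp: controls_def)
    moreover have "K * sqrt (\<Sum>t. (norm (w k t))\<^sup>2) \<le> \<bar>K\<bar> * sqrt (4 * e k / \<delta>)"
      using n2[of k] w[of k] by (intro mult_mono) (auto simp: controls_def suminf_nonneg)
    moreover have "J (\<lambda>t. u t + w k t) = J (U k)" by (simp add: w_def)
    ultimately show ?thesis using K[OF w[of k]] U(2)[of k] by linarith
  qed
  moreover have "(\<lambda>k. m + e k + \<bar>K\<bar> * sqrt (4 * e k / \<delta>)) \<longlonglongrightarrow> m + 0 + \<bar>K\<bar> * sqrt (4 * 0 / \<delta>)"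
    using \<delta> by (intro tendsto_intros e0) auto
  ultimately have "J u \<le> m + 0 + \<bar>K\<bar> * sqrt (4 * 0 / \<delta>)"
    by (intro LIMSEQ_le_const) auto
  then have "J u \<le> m" by simp
  then have "J u \<le> J v" if "v \<in> controls" for v
    using cInf_lower[OF imageI[OF that] bdd_below_J] by (simp add: m_def)
  then show ?thesis using \<open>u \<in> controls\<close> by (auto simp: optimal_control_def)
qed

end

section \<open>Coercivity of the deterministic cost\<close>

lemma det_state_add:
  "det_state A b (x + y) (\<lambda>t. u t + v t) t = det_state A b x u t + det_state A b y v t"
  by (induction t) (simp_all add: matrix_vector_right_distrib algebra_simps)

lemma det_state_scaleR:
  "det_state A b (c *\<^sub>R x) (\<lambda>t. c *\<^sub>R u t) t = c *\<^sub>R det_state A b x u t"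
  by (induction t) (simp_all add: matrix_vector_mult_scaleR scaleR_right_distrib)

context
  fixes A :: "real ^ 'n ^ 'n" and b \<gamma> :: "real ^ 'm ^ 'n" and Q :: "real ^ 'n ^ 'n" and \<Gamma> :: "real ^ 'm ^ 'm"
  assumes A: "\<And>x. (\<lambda>t. ((*v) A ^^ t) x) \<longlonglongrightarrow> 0"
begin

abbreviation (input) det_total_cost :: "real ^ 'n \<Rightarrow> (nat \<Rightarrow> real ^ 'm) \<Rightarrow> real" where
  "det_total_cost y0 u \<equiv> \<Sum>t. cost Q \<gamma> \<Gamma> (det_state A b y0 u t) (u t)"

lemma summable_norm_det_pair:
  "u \<in> controls \<Longrightarrow> summable (\<lambda>t. (norm (det_state A b y0 u t, u t))\<^sup>2)"
  by (intro summable_pair det_state_summable A) (auto simp: controls_def)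

text \<open>For every horizon \<open>N\<close> the periodic state starts at a solution \<open>x0\<close> of \<open>x0 - A\<^sup>N x0 = y N\<close>,
  so it differs from \<open>y\<close> by the orbit \<open>A\<^sup>t x0\<close>, and \<open>x0\<close> tends to \<open>0\<close> with \<open>N\<close>.\<close>

lemma frequency_bound_coercive:
  assumes freq: "frequency_bound A b (cmat Q) \<gamma> \<Gamma> \<delta>" and u: "u \<in> controls"
  shows "\<delta> * (\<Sum>t. (norm (u t))\<^sup>2) \<le> det_total_cost 0 u"
proof -
  let ?y = "det_state A b 0 u"
  let ?B = "cost_bilinear Q \<gamma> \<Gamma>"
  note lin = matrix_vector_mul_linear[of A]
  interpret B: bounded_bilinear ?B by (rule bounded_bilinear_cost_bilinear)
  obtain K where K: "0 \<le> K" "\<And>z z'. norm (?B z z') \<le> norm z * norm z' * K"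
    using B.nonneg_bounded by blast
  obtain L where L: "1 \<le> L" "\<And>x n. (\<Sum>t<n. norm (((*v) A ^^ t) x)) \<le> L * norm x"
    by (rule stable_partial_sums[OF lin A], rule that)
  have L1: "norm (((*v) A ^^ t) x) \<le> L * norm x" for t x
    using L(2)[where n = "Suc t" and x = x] sum_nonneg[of "{..<t}" "\<lambda>t. norm (((*v) A ^^ t) x)"] by simp
  have "(\<lambda>t. (norm (?y t, u t))\<^sup>2) \<longlonglongrightarrow> 0"
    by (rule summable_LIMSEQ_zero[OF summable_norm_det_pair[OF u]])
  from tendsto_real_sqrt[OF this] have pair0: "(\<lambda>t. (?y t, u t)) \<longlonglongrightarrow> 0"
    by (simp add: tendsto_norm_zero_iff)
  then have "Bseq (\<lambda>t. (?y t, u t))" by (intro convergent_imp_Bseq convergentI)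
  then obtain Z where Z: "0 < Z" "\<And>t. norm (?y t, u t) \<le> Z" by (auto elim: BseqE)
  have y0: "?y \<longlonglongrightarrow> 0" using tendsto_fst[OF pair0] by (simp add: zero_prod_def)
  \<comment> \<open>This bounds the change of the cost caused by a correction of the initial state
    of norm at most \<open>r\<close>: the corrections along the orbit add up to at most
    \<open>L * r\<close>, and each is multiplied by at most
    \<open>K * (2 * Z + L * r)\<close>.\<close>
  define err where "err r = K * L * r * (2 * Z + L * r)" for r
  have err0: "(\<lambda>N. err (2 * norm (?y N))) \<longlonglongrightarrow> 0"
  proof -
    have "(\<lambda>N. err (2 * norm (?y N))) \<longlonglongrightarrow> err (2 * norm (0 :: real ^ 'n))"
      unfolding err_def by (intro tendsto_intros y0)
    then show ?thesis by (simp add: err_def)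
  qed
  \<comment> \<open>Halving makes \<open>x \<mapsto> x - (A ^^ N) x\<close> injective, hence onto,
    and bounds the solution \<open>x0\<close> by \<open>2 * norm (?y N)\<close>.\<close>
  have "\<forall>\<^sub>F N in sequentially. (\<forall>x. norm (((*v) A ^^ N) x) \<le> norm x / 2) \<and> N > 0"
    using stable_power_bound(2)[OF lin A] eventually_gt_at_top[of 0] by (rule eventually_conj)
  then have ev: "\<forall>\<^sub>F N in sequentially. \<delta> * (\<Sum>t<N. (norm (u t))\<^sup>2)
      \<le> (\<Sum>t<N. cost Q \<gamma> \<Gamma> (?y t) (u t)) + err (2 * norm (?y N))"
  proof eventually_elim
    case (elim N)
    then have half: "norm (((*v) A ^^ N) x) \<le> norm x / 2" and N: "N > 0" for x by auto
    let ?g = "\<lambda>x. x - ((*v) A ^^ N) x"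
    have "linear ?g" by (intro linear_compose_sub linear_ident linear_funpow lin)
    moreover have "inj ?g"
      unfolding linear_injective_0[OF \<open>linear ?g\<close>]
    proof (intro allI impI)
      fix x assume "?g x = 0"
      then have "norm x \<le> norm x / 2" using half[of x] by simp
      then show "x = 0" by simp
    qed
    ultimately have "surj ?g" by (rule linear_injective_imp_surjective) (rule refl)
    then obtain x0 where x0: "?g x0 = ?y N" by (metis surjD)
    have "norm x0 \<le> norm (?y N) + norm (((*v) A ^^ N) x0)"
      using norm_triangle_ineq[of "?y N" "((*v) A ^^ N) x0"] x0[symmetric] by simp
    with half[of x0] have x0_le: "norm x0 \<le> 2 * norm (?y N)" by linarith
    let ?d = "\<lambda>t. (((*v) A ^^ t) x0, 0 :: real ^ 'm)"
    let ?x = "det_state A b x0 u"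
    have xd: "?x t = ?y t + ((*v) A ^^ t) x0" for t
      using det_state_add[of A b 0 x0 u "\<lambda>_. 0" t] by (simp add: det_state_uncontrolled)
    have "?x N = ?x 0" using x0 unfolding xd[of N] by (simp add: algebra_simps)
    then have "\<delta> * (\<Sum>t<N. (norm (u t))\<^sup>2) \<le> (\<Sum>t<N. cost Q \<gamma> \<Gamma> (?x t) (u t))"
      by (intro periodic_cost_bound[OF A freq _ _ N]) simp_all
    also have "\<dots> \<le> (\<Sum>t<N. cost Q \<gamma> \<Gamma> (?y t) (u t) + norm (((*v) A ^^ t) x0) * (K * (2 * Z + L * norm x0)))"
    proof (intro sum_mono)
      fix t
      let ?z = "(?y t, u t)"
      have nd: "norm (?d t) = norm (((*v) A ^^ t) x0)" by (simp add: norm_Pair)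
      have "cost Q \<gamma> \<Gamma> (?x t) (u t) = ?B (?z + ?d t) (?z + ?d t)"
        by (simp add: cost_eq_bilinear xd)
      also have "\<dots> = ?B ?z ?z + (?B ?z (?d t) + ?B (?d t) ?z + ?B (?d t) (?d t))"
        unfolding B.add_left B.add_right by simp
      also have "\<dots> \<le> ?B ?z ?z + (norm ?z * norm (?d t) * K + norm (?d t) * norm ?z * K + norm (?d t) * norm (?d t) * K)"
        using K(2)[of ?z "?d t"] K(2)[of "?d t" ?z] K(2)[of "?d t" "?d t"] unfolding real_norm_def by linarith
      also have "\<dots> = ?B ?z ?z + norm (?d t) * (K * (2 * norm ?z + norm (?d t)))"
        by (simp add: algebra_simps)
      also have "\<dots> \<le> ?B ?z ?z + norm (?d t) * (K * (2 * Z + L * norm x0))"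
        using K(1) Z(2)[of t] L1[of t x0] unfolding nd
        by (intro add_left_mono mult_left_mono add_mono) auto
      finally show "cost Q \<gamma> \<Gamma> (?x t) (u t)
          \<le> cost Q \<gamma> \<Gamma> (?y t) (u t) + norm (((*v) A ^^ t) x0) * (K * (2 * Z + L * norm x0))"
        by (simp only: nd cost_eq_bilinear)
    qed
    also have "\<dots> = (\<Sum>t<N. cost Q \<gamma> \<Gamma> (?y t) (u t))
        + (\<Sum>t<N. norm (((*v) A ^^ t) x0)) * (K * (2 * Z + L * norm x0))"
      by (simp add: sum.distrib sum_distrib_right)
    also have "\<dots> \<le> (\<Sum>t<N. cost Q \<gamma> \<Gamma> (?y t) (u t)) + (L * norm x0) * (K * (2 * Z + L * norm x0))"
      using K(1) Z(1) L by (intro add_left_mono mult_right_mono) auto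
    also have "\<dots> \<le> (\<Sum>t<N. cost Q \<gamma> \<Gamma> (?y t) (u t))
        + (L * (2 * norm (?y N))) * (K * (2 * Z + L * (2 * norm (?y N))))"
      using K(1) Z(1) L(1) x0_le by (intro add_left_mono mult_mono mult_left_mono) auto
    finally show ?case by (simp add: err_def mult_ac)
  qed
  have "(\<lambda>N. \<delta> * (\<Sum>t<N. (norm (u t))\<^sup>2)) \<longlonglongrightarrow> \<delta> * (\<Sum>t. (norm (u t))\<^sup>2)"
    using u by (intro tendsto_mult_left summable_LIMSEQ) (simp add: controls_def)
  moreover have "summable (\<lambda>t. cost Q \<gamma> \<Gamma> (?y t) (u t))"
    using u by (intro summable_cost det_state_summable A) (auto simp: controls_def)
  then have "(\<lambda>N. (\<Sum>t<N. cost Q \<gamma> \<Gamma> (?y t) (u t)) + err (2 * norm (?y N))) \<longlonglongrightarrow> det_total_cost 0 u + 0"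
    by (intro tendsto_add err0 summable_LIMSEQ)
  ultimately show ?thesis
    using tendsto_le[OF sequentially_bot _ _ ev] by fastforce
qed

text \<open>The pair of state and control is jointly linear in initial state and control. The
  difference of two trajectories from \<open>y0\<close> therefore starts at 0, and the quadratic
  part of the cost is the cost for zero initial state.\<close>

lemma coercive_quadratic_det_cost:
  assumes Q: "transpose Q = Q" and \<Gamma>: "transpose \<Gamma> = \<Gamma>"
    and \<delta>: "\<delta> > 0" and freq: "frequency_bound A b (cmat Q) \<gamma> \<Gamma> \<delta>"
  shows "coercive_quadratic (det_total_cost y0) (det_total_cost 0) \<delta>"
proof
  let ?B = "cost_bilinear Q \<gamma> \<Gamma>"
  interpret B: bounded_bilinear ?B by (rule bounded_bilinear_cost_bilinear)
  note comm = cost_bilinear_commute[OF Q \<Gamma>]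
  define z where "z x u t = (det_state A b x u t, u t)" for x u t
  have cost_z: "cost Q \<gamma> \<Gamma> (det_state A b x u t) (u t) = ?B (z x u t) (z x u t)" for x u t
    by (simp add: z_def cost_eq_bilinear)
  have z_add: "z (x + y) (\<lambda>t. u t + v t) t = z x u t + z y v t" for x y u v t
    by (simp add: z_def det_state_add)
  have z_scale: "z (c *\<^sub>R x) (\<lambda>t. c *\<^sub>R u t) t = c *\<^sub>R z x u t" for c x u t
    by (simp add: z_def det_state_scaleR)
  have zz: "summable (\<lambda>t. (norm (z x u t))\<^sup>2)" if "u \<in> controls" for x u
    unfolding z_def by (rule summable_norm_det_pair[OF that])
  have Bz: "summable (\<lambda>t. ?B (z x u t) (z y v t))" if "u \<in> controls" "v \<in> controls" for x y u v
    by (rule summable_bilinear[OF bounded_bilinear_cost_bilinear zz[OF that(1)] zz[OF that(2)]])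
  show "\<delta> > 0" by fact
  show "\<delta> * (\<Sum>t. (norm (w t))\<^sup>2) \<le> det_total_cost 0 w" if "w \<in> controls" for w
    by (rule frequency_bound_coercive[OF freq that])
  show "det_total_cost y0 (\<lambda>t. (1/2) *\<^sub>R (u t + v t))
      = (det_total_cost y0 u + det_total_cost y0 v) / 2 - det_total_cost 0 (\<lambda>t. u t - v t) / 4"
    if u: "u \<in> controls" and v: "v \<in> controls" for u v
  proof -
    \<comment> \<open>The midpoint trajectory starts at \<open>y0\<close> because it is half of the
      trajectory that starts at \<open>y0 + y0\<close>.\<close>
    have mid: "z y0 (\<lambda>t. (1/2) *\<^sub>R (u t + v t)) t = (1/2) *\<^sub>R (z y0 u t + z y0 v t)" for t
      using z_scale[of "1/2" "y0 + y0" "\<lambda>t. u t + v t" t] z_add[of y0 y0 u v t]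
      by (simp flip: scaleR_2)
    have diff: "z 0 (\<lambda>t. u t - v t) t = z y0 u t - z y0 v t" for t
      using z_add[of 0 y0 "\<lambda>t. u t - v t" v t] by simp
    have "?B (z y0 (\<lambda>t. (1/2) *\<^sub>R (u t + v t)) t) (z y0 (\<lambda>t. (1/2) *\<^sub>R (u t + v t)) t)
      = (?B (z y0 u t) (z y0 u t) + ?B (z y0 v t) (z y0 v t)) / 2
        - ?B (z 0 (\<lambda>t. u t - v t) t) (z 0 (\<lambda>t. u t - v t) t) / 4" for t
      unfolding mid diff
      by (simp add: B.add_left B.add_right B.diff_left B.diff_right B.scaleR_left B.scaleR_right
          comm[of \<gamma> "z y0 v t" "z y0 u t"] field_simps)
    then have "(\<lambda>t. cost Q \<gamma> \<Gamma> (det_state A b y0 (\<lambda>t. (1/2) *\<^sub>R (u t + v t)) t) ((1/2) *\<^sub>R (u t + v t)))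
      = (\<lambda>t. (cost Q \<gamma> \<Gamma> (det_state A b y0 u t) (u t) + cost Q \<gamma> \<Gamma> (det_state A b y0 v t) (v t)) / 2
        - cost Q \<gamma> \<Gamma> (det_state A b 0 (\<lambda>t. u t - v t) t) (u t - v t) / 4)"
      using cost_z[of _ "\<lambda>t. (1/2) *\<^sub>R (u t + v t)"] cost_z[of _ "\<lambda>t. u t - v t"] cost_z[of y0]
      by (simp only:)
    moreover have sm: "summable (\<lambda>t. cost Q \<gamma> \<Gamma> (det_state A b x w t) (w t))" if "w \<in> controls" for x w
      unfolding cost_z by (rule Bz[OF that that])
    have "(\<lambda>t. (cost Q \<gamma> \<Gamma> (det_state A b y0 u t) (u t) + cost Q \<gamma> \<Gamma> (det_state A b y0 v t) (v t)) / 2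
        - cost Q \<gamma> \<Gamma> (det_state A b 0 (\<lambda>t. u t - v t) t) (u t - v t) / 4)
      sums ((det_total_cost y0 u + det_total_cost y0 v) / 2 - det_total_cost 0 (\<lambda>t. u t - v t) / 4)"
      by (intro sums_diff sums_divide sums_add summable_sums sm u v controls_diff)
    ultimately show ?thesis by (simp add: sums_iff)
  qed
  show "\<exists>K. \<forall>w\<in>controls. \<bar>det_total_cost y0 (\<lambda>t. u t + w t) - det_total_cost y0 u - det_total_cost 0 w\<bar>
      \<le> K * sqrt (\<Sum>t. (norm (w t))\<^sup>2)" if u: "u \<in> controls" for u
  proof -
    obtain K where K: "0 \<le> K" "\<And>z z'. norm (?B z z') \<le> norm z * norm z' * K"
      using B.nonneg_bounded by blast
    obtain L where L: "0 \<le> L" "\<forall>y0. \<forall>u\<in>controls. \<forall>n.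
      (\<Sum>t<n. (norm (det_state A b y0 u t))\<^sup>2) \<le> L * ((norm y0)\<^sup>2 + (\<Sum>t. (norm (u t))\<^sup>2))"
      using det_state_energy[OF A, of b] by blast
    \<comment> \<open>The remainder is twice the mixed term of the bilinear form, estimated by
      Cauchy-Schwarz. In \<open>L + 1\<close>, the energy of the state accounts for \<open>L\<close>
      and that of the control for 1.\<close>
    define R where "R = 2 * K * sqrt (\<Sum>t. (norm (z y0 u t))\<^sup>2) * sqrt (L + 1)"
    have "\<bar>det_total_cost y0 (\<lambda>t. u t + w t) - det_total_cost y0 u - det_total_cost 0 w\<bar>
        \<le> R * sqrt (\<Sum>t. (norm (w t))\<^sup>2)" if w: "w \<in> controls" for w
    proof -
      let ?p = "z y0 u" and ?q = "z 0 w"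
      have w2: "summable (\<lambda>t. (norm (w t))\<^sup>2)" using w by (simp add: controls_def)
      have y2: "summable (\<lambda>t. (norm (det_state A b 0 w t))\<^sup>2)" by (rule det_state_summable[OF A w])
      have q2: "(\<Sum>t. (norm (?q t))\<^sup>2) \<le> (L + 1) * (\<Sum>t. (norm (w t))\<^sup>2)"
      proof -
        have "(\<Sum>t. (norm (det_state A b 0 w t))\<^sup>2) \<le> L * (\<Sum>t. (norm (w t))\<^sup>2)"
          using L(2)[rule_format, OF w, of 0] by (intro suminf_le_const y2) simp
        then show ?thesis
          by (simp add: z_def norm_Pair suminf_add[OF y2 w2, symmetric] distrib_right)
      qed
      have sum_B: "?B (z y0 (\<lambda>t. u t + w t) t) (z y0 (\<lambda>t. u t + w t) t)
          = ?B (?p t) (?p t) + ?B (?q t) (?q t) + 2 * ?B (?p t) (?q t)" for t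
        using z_add[of y0 0 u w t] comm[of \<gamma> "?q t" "?p t"] by (simp add: B.add_left B.add_right)
      have "(\<Sum>t. ?B (z y0 (\<lambda>t. u t + w t) t) (z y0 (\<lambda>t. u t + w t) t))
          = (\<Sum>t. ?B (?p t) (?p t)) + (\<Sum>t. ?B (?q t) (?q t)) + 2 * (\<Sum>t. ?B (?p t) (?q t))"
        unfolding sum_B
        by (simp add: suminf_add[symmetric] suminf_mult Bz u w summable_add summable_mult)
      then have "\<bar>det_total_cost y0 (\<lambda>t. u t + w t) - det_total_cost y0 u - det_total_cost 0 w\<bar>
          = \<bar>2 * (\<Sum>t. ?B (?p t) (?q t))\<bar>"
        using cost_z[of y0 "\<lambda>t. u t + w t"] by (simp add: cost_z)
      also have "\<dots> \<le> 2 * (K * (sqrt (\<Sum>t. (norm (?p t))\<^sup>2) * sqrt (\<Sum>t. (norm (?q t))\<^sup>2)))"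
      proof -
        have "\<bar>\<Sum>t<n. ?B (?p t) (?q t)\<bar> \<le> K * (sqrt (\<Sum>t. (norm (?p t))\<^sup>2) * sqrt (\<Sum>t. (norm (?q t))\<^sup>2))" for n
        proof -
          have "\<bar>\<Sum>t<n. ?B (?p t) (?q t)\<bar> \<le> (\<Sum>t<n. norm (?p t) * norm (?q t) * K)"
            using K(2) by (intro order_trans[OF sum_abs] sum_mono) simp
          also have "\<dots> = K * (\<Sum>t<n. norm (?p t) * norm (?q t))"
            by (simp add: sum_distrib_left mult_ac)
          also have "\<dots> \<le> K * (sqrt (\<Sum>t. (norm (?p t))\<^sup>2) * sqrt (\<Sum>t. (norm (?q t))\<^sup>2))"
            by (intro mult_left_mono K Cauchy_Schwarz_summable zz u w)
          finally show ?thesis .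
        qed
        moreover have "(\<lambda>n. \<bar>\<Sum>t<n. ?B (?p t) (?q t)\<bar>) \<longlonglongrightarrow> \<bar>\<Sum>t. ?B (?p t) (?q t)\<bar>"
          by (intro tendsto_rabs summable_LIMSEQ Bz u w)
        ultimately have "\<bar>\<Sum>t. ?B (?p t) (?q t)\<bar> \<le> K * (sqrt (\<Sum>t. (norm (?p t))\<^sup>2) * sqrt (\<Sum>t. (norm (?q t))\<^sup>2))"
          by (intro LIMSEQ_le_const2) auto
        then show ?thesis by (simp add: abs_mult)
      qed
      also have "\<dots> \<le> 2 * (K * (sqrt (\<Sum>t. (norm (?p t))\<^sup>2) * sqrt ((L + 1) * (\<Sum>t. (norm (w t))\<^sup>2))))"
        using K(1) suminf_nonneg[OF zz[OF u, of y0]] q2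
        by (intro mult_left_mono real_sqrt_le_mono) auto
      also have "\<dots> = R * sqrt (\<Sum>t. (norm (w t))\<^sup>2)"
        by (simp add: R_def real_sqrt_mult)
      finally show ?thesis .
    qed
    then show ?thesis by blast
  qed
qed

end

section \<open>The optimal controls\<close>

lemma map_matrix_Re_cmat_mult:
  "map_matrix Re (cmat A ** H) = A ** map_matrix Re H"
  "map_matrix Re (H ** cmat A) = map_matrix Re H ** A"
  and map_matrix_Im_cmat_mult:
  "map_matrix Im (cmat A ** H) = A ** map_matrix Im H"
  "map_matrix Im (H ** cmat A) = map_matrix Im H ** A"
  by (simp_all add: vec_eq_iff matrix_matrix_mult_def)

lemma transpose_cmat: "transpose (cmat A) = cmat (transpose A)"
  by (simp add: vec_eq_iff transpose_def)

lemma map_matrix_Re_Im_simps: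
  "map_matrix Re (X + Y) = map_matrix Re X + map_matrix Re Y" "map_matrix Im (X + Y) = map_matrix Im X + map_matrix Im Y"
  "map_matrix Re (X - Y) = map_matrix Re X - map_matrix Re Y" "map_matrix Im (X - Y) = map_matrix Im X - map_matrix Im Y"
  "map_matrix Re 0 = 0" "map_matrix Im 0 = 0"
  by (simp_all add: vec_eq_iff)

lemma map_matrix_cmat: "map_matrix Re (cmat A) = A" "map_matrix Im (cmat A) = 0"
  by (simp_all add: vec_eq_iff)

lemma optimal_control_cong:
  assumes "\<And>u v. u \<in> controls \<Longrightarrow> v \<in> controls \<Longrightarrow> f u \<le> f v \<longleftrightarrow> g u \<le> g v"
  shows "optimal_control f u \<longleftrightarrow> optimal_control g u"
  using assms by (auto simp: optimal_control_def)

theorem theorem3p2: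
  fixes M :: "'w measure" and F :: "nat \<Rightarrow> 'w measure"
    and \<xi> :: "nat \<Rightarrow> 'w \<Rightarrow> real" and a :: "'w \<Rightarrow> real ^ 'n"
    and A C G :: "real ^ 'n ^ 'n" and b \<gamma> :: "real ^ 'm ^ 'n" and \<Gamma> :: "real ^ 'm ^ 'm"
    and H \<Theta> :: "complex ^ 'n ^ 'n"
  assumes "prob_space M"
    and "filtration (space M) F" and "\<And>t. subalgebra M (F t)"
    and "white_noise M F \<xi>"
    and "admissible_init M F \<xi> a"
    and "transpose G = G" and "transpose \<Gamma> = \<Gamma>"
    and "matrix_spectral_radius (cmat A) < 1"
    and "mean_square_stable M F \<xi> A b C"
    and "transpose H = H" and "transpose \<Theta> = \<Theta>"
    and "transpose (cmat A) ** H ** cmat A - H + \<Theta> = 0"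
    and "\<Theta> - transpose (cmat C) ** H ** cmat C - cmat G = 0"
  defines "\<Phi> \<equiv> stoch_cost M \<xi> a A b C G \<gamma> \<Gamma>"
    and "\<Phi>\<^sub>1 \<equiv> det_cost A b (prob_space.expectation M a) \<Theta> \<gamma> \<Gamma>"
  shows "((\<exists>u. optimal_control \<Phi> u) \<longleftrightarrow> (\<exists>u. optimal_control \<Phi>\<^sub>1 u))
    \<and> ((\<exists>\<delta>>0. \<forall>z. cmod z = 1 \<longrightarrow> (\<forall>u :: complex ^ 'm.
            cost_form \<Theta> (cmat \<gamma>) (cmat \<Gamma>) (matrix_inv (mat z - cmat A) *v (cmat b *v u)) u
              \<ge> complex_of_real (\<delta> * (norm u)\<^sup>2)))
        \<longrightarrow> (\<exists>u. optimal_control \<Phi> u)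
          \<and> (\<forall>u. optimal_control \<Phi> u \<longleftrightarrow> optimal_control \<Phi>\<^sub>1 u)
          \<and> (\<forall>u v. optimal_control \<Phi> u \<and> optimal_control \<Phi>\<^sub>1 v \<longrightarrow> control_equiv u v))"
proof -
  interpret noisy_filtration M F \<xi>
    using assms(1-4) by (simp add: noisy_filtration_def noisy_filtration_axioms_def)
  note stable = \<open>mean_square_stable M F \<xi> A b C\<close>
  note A0 = matrix_power_tendsto_0[OF stable]
  have a: "a \<in> borel_measurable (F 0)" "sq_integrable M a"
    using \<open>admissible_init M F \<xi> a\<close> measurable_from_subalg[OF subalgebra]
    by (auto simp: admissible_init_def sq_integrable_def)
  define HR where "HR = map_matrix Re H"
  define Q where "Q = map_matrix Re \<Theta>"
  have ReH: "transpose A ** HR ** A - HR + Q = 0" and ReQ: "Q - transpose C ** HR ** C - G = 0"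
    using arg_cong[OF assms(12), of "map_matrix Re"] arg_cong[OF assms(13), of "map_matrix Re"]
    by (simp_all add: map_matrix_Re_Im_simps map_matrix_Re_cmat_mult transpose_cmat map_matrix_cmat HR_def Q_def)
  \<comment> \<open>As \<open>A\<close>, \<open>C\<close> and \<open>G\<close> are real, the
    imaginary parts satisfy the homogeneous equations; eliminating the imaginary part of \<Theta>
    leaves a fixed point of the adjoint covariance map.\<close>
  have ImH: "transpose A ** map_matrix Im H ** A - map_matrix Im H + map_matrix Im \<Theta> = 0"
    and ImQ: "map_matrix Im \<Theta> - transpose C ** map_matrix Im H ** C = 0"
    using arg_cong[OF assms(12), of "map_matrix Im"] arg_cong[OF assms(13), of "map_matrix Im"]
    by (simp_all add: map_matrix_Re_Im_simps map_matrix_Im_cmat_mult transpose_cmat map_matrix_cmat)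
  have "map_matrix Im H = transpose A ** map_matrix Im H ** A + transpose C ** map_matrix Im H ** C"
    using ImH ImQ by (simp add: algebra_simps eq_neg_iff_add_eq_0)
  then have "map_matrix Im H = 0" by (rule covariance_op_fixpoint_eq_0[OF stable])
  with ImQ have "map_matrix Im \<Theta> = 0" by (simp add: matrix_matrix_mult_def vec_eq_iff)
  then have \<Theta>: "\<Theta> = cmat Q" by (simp add: Q_def vec_eq_iff complex_eq_iff)
  have Q: "transpose Q = Q"
    using \<open>transpose \<Theta> = \<Theta>\<close> by (simp add: Q_def vec_eq_iff transpose_def)
  define J where "J u = (\<Sum>t. cost Q \<gamma> \<Gamma> (det_state A b (expectation a) u t) (u t))" for u
  have J: "\<Phi> u \<le> \<Phi> v \<longleftrightarrow> J u \<le> J v" "\<Phi>\<^sub>1 u \<le> \<Phi>\<^sub>1 v \<longleftrightarrow> J u \<le> J v" if "u \<in> controls" "v \<in> controls" for u v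
  proof -
    show "\<Phi> u \<le> \<Phi> v \<longleftrightarrow> J u \<le> J v"
      by (simp add: \<Phi>_def stoch_cost_eq[OF stable a ReH ReQ] that J_def)
    \<comment> \<open>Convergence of the real series for square-summable controls is what permits
      moving the embedding out of the infinite sum.\<close>
    have "\<Phi>\<^sub>1 u = complex_of_real (J u)" if u: "u \<in> controls" for u
      unfolding \<Phi>\<^sub>1_def det_cost_def J_def \<Theta> cost_form_cvec
      using u by (intro suminf_of_real[symmetric] summable_cost det_state_summable A0)
        (auto simp: controls_def)
    then show "\<Phi>\<^sub>1 u \<le> \<Phi>\<^sub>1 v \<longleftrightarrow> J u \<le> J v"
      by (simp add: that less_eq_complex_def)
  qed
  have opt: "optimal_control \<Phi> u \<longleftrightarrow> optimal_control J u" "optimal_control \<Phi>\<^sub>1 u \<longleftrightarrow> optimal_control J u" for u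
    by (rule optimal_control_cong, rule J, assumption+)+
  \<comment> \<open>Both optimality notions have become optimality for \<open>J\<close>, so the
    equivalence of existence and the identity of the optimal controls are immediate.\<close>
  show ?thesis
    unfolding opt
  proof (intro conjI impI)
    assume "\<exists>\<delta>>0. \<forall>z. cmod z = 1 \<longrightarrow> (\<forall>u :: complex ^ 'm.
            cost_form \<Theta> (cmat \<gamma>) (cmat \<Gamma>) (matrix_inv (mat z - cmat A) *v (cmat b *v u)) u
              \<ge> complex_of_real (\<delta> * (norm u)\<^sup>2))"
    then obtain \<delta> where \<delta>: "\<delta> > 0" "frequency_bound A b (cmat Q) \<gamma> \<Gamma> \<delta>"
      unfolding frequency_bound_def \<Theta> by blast
    interpret coercive_quadratic J "\<lambda>u. \<Sum>t. cost Q \<gamma> \<Gamma> (det_state A b 0 u t) (u t)" \<delta>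
      unfolding J_def[abs_def]
      by (rule coercive_quadratic_det_cost[OF A0 Q \<open>transpose \<Gamma> = \<Gamma>\<close> \<delta>])
    show "\<exists>u. optimal_control J u" by (rule optimal_control_exists)
    show "\<forall>u v. optimal_control J u \<and> optimal_control J v \<longrightarrow> control_equiv u v"
      using optimal_control_equiv by blast
  qed auto
qed

end
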